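(* Let $(u_m)_{m\in\mathbb{N}}\subset\mathcal{U}$ be a sequence of admissible controls such that $u_m\rightharpoonup u_\infty$ weakly in $L^2$ as $m\to\infty$. For every $m\in\mathbb{N}\cup\{\infty\}$ let $X_m:[0,1]\times\Theta\to\mathbb{R}^n$ be defined by $X_m(t,\theta):=x_{u_m}^\theta(t)$. Then $$\lim_{m\to\infty}\ \sup_{(t,\theta)\in[0,1]\times\Theta}|X_m(t,\theta)-X_\infty(t,\theta)|_2=0 .$$
   Context: Let $n,k\ge 1$ and let $\Theta$ be a compact subset of a finite-dimensional Euclidean space. Let $F_0:\mathbb{R}^n\times\Theta\to\mathbb{R}^n$ and $F=(F_1,\dots,F_k):\mathbb{R}^n\times\Theta\to\mathbb{R}^{n\times k}$ ($F_i$ is the $i$-th column of $F$) be such that, for some $L>0$, $|F_i(x_1,\theta_1)-F_i(x_2,\theta_2)|_2\le L(|x_1-x_2|_2+|\theta_1-\theta_2|_2)$ for all $i=0,\dots,k$ and all $(x_1,\theta_1),(x_2,\theta_2)\in\mathbb{R}^n\times\Theta$. Let $x_0:\Theta\to\mathbb{R}^n$ be continuous. Set $\mathcal{U}:=L^2([0,1],\mathbb{R}^k)$ (the space of admissible controls). For $u\in\mathcal{U}$ and $\theta\in\Theta$, $x_u^\theta:[0,1]\to\mathbb{R}^n$ is the unique absolutely continuous solution of $\dot x(t)=F_0(x(t),\theta)+F(x(t),\theta)u(t)$ for a.e. $t\in[0,1]$, $x(0)=x_0(\theta)$. *)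

theory Defs
  imports "HOL-Analysis.Analysis"
begin

text \<open>Elements of $L^2([0,1],\mathbb{R}^k)$ are represented by functions on the whole real line;
  only their values on $[0,1]$, up to null sets, matter below.\<close>

definition L2_controls :: "(real \<Rightarrow> real ^ 'k) set" where
  "L2_controls = {u. u \<in> borel_measurable (lebesgue_on {0..1}) \<and>
     integrable (lebesgue_on {0..1}) (\<lambda>t. (norm (u t))\<^sup>2)}"

text \<open>Weak convergence in the Hilbert space $L^2$: convergence of the inner products with
  every fixed element.\<close>

definition weakly_converges_L2 :: "(nat \<Rightarrow> real \<Rightarrow> real ^ 'k) \<Rightarrow> (real \<Rightarrow> real ^ 'k) \<Rightarrow> bool" where
  "weakly_converges_L2 u v \<longleftrightarrow>
     (\<forall>m. u m \<in> L2_controls) \<and> v \<in> L2_controls \<and>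
     (\<forall>w\<in>L2_controls.
        (\<lambda>m. LINT t|lebesgue_on {0..1}. u m t \<bullet> w t)
          \<longlonglongrightarrow> (LINT t|lebesgue_on {0..1}. v t \<bullet> w t))"

text \<open>A pair $(a,b)$ in \<open>S\<close> stands for the interval $[a,b]$; the intervals may share endpoints.\<close>

definition abs_continuous_on :: "real set \<Rightarrow> (real \<Rightarrow> 'a::real_normed_vector) \<Rightarrow> bool" where
  "abs_continuous_on I f \<longleftrightarrow>
     (\<forall>\<epsilon>>0. \<exists>\<delta>>0. \<forall>S :: (real \<times> real) set.
        finite S \<and> (\<forall>(a, b)\<in>S. a \<le> b \<and> {a..b} \<subseteq> I) \<and>
        disjoint_family_on (\<lambda>(a, b). {a<..<b}) S \<and>
        (\<Sum>(a, b)\<in>S. b - a) < \<delta> \<longrightarrow>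
        (\<Sum>(a, b)\<in>S. norm (f b - f a)) < \<epsilon>)"

text \<open>The function \<open>x\<close> is, on $[0,1]$, the trajectory $x_u^\theta$. The one-sided derivatives at the
  endpoints are irrelevant, since the equation is only required almost everywhere.\<close>

definition is_trajectory ::
  "(real ^ 'n \<Rightarrow> 'p \<Rightarrow> real ^ 'n) \<Rightarrow> (real ^ 'n \<Rightarrow> 'p \<Rightarrow> real ^ 'k ^ 'n) \<Rightarrow> ('p \<Rightarrow> real ^ 'n) \<Rightarrow>
   (real \<Rightarrow> real ^ 'k) \<Rightarrow> 'p \<Rightarrow> (real \<Rightarrow> real ^ 'n) \<Rightarrow> bool" where
  "is_trajectory F0 F x0 u \<theta> x \<longleftrightarrow>
     abs_continuous_on {0..1} x \<and>
     (AE t in lebesgue_on {0..1}.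
        (x has_vector_derivative F0 (x t) \<theta> + F (x t) \<theta> *v u t) (at t within {0..1})) \<and>
     x 0 = x0 \<theta>"

end

theory Submission
  imports Defs
begin

text \<open>Writing \<open>x\<^sub>m\<close> for \<open>X\<^sub>m(\<cdot>, \<theta>)\<close> and \<open>y\<close> for \<open>X\<^sub>\<infinity>(\<cdot>, \<theta>)\<close>, the integral equations give
  \<open>x\<^sub>m - y = \<integral> (F\<^sub>0(x\<^sub>m) - F\<^sub>0(y)) + (F(x\<^sub>m) - F(y)) u\<^sub>m + \<integral> F(y) (u\<^sub>m - u\<^sub>\<infinity>)\<close>.
  By Gronwall's inequality, whose constant depends only on a bound for the \<open>L\<^sup>2\<close> norms of the \<open>u\<^sub>m\<close>
  (uniform boundedness principle), it suffices that the last integral tends to \<open>0\<close> uniformly in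
  \<open>(t, \<theta>)\<close>. For fixed \<open>(t, \<theta>)\<close> this is weak convergence, tested against the rows of
  \<open>F(y, \<theta>)\<close> cut off at \<open>t\<close>; and as functions of \<open>(t, \<theta>)\<close> these integrals are equicontinuous on
  the compact set \<open>[0,1] \<times> \<Theta>\<close>, since \<open>y\<close> depends continuously on \<open>\<theta>\<close>.\<close>

section \<open>Absolutely continuous functions are integrals of their derivatives\<close>

text \<open>Weak convergence can only be tested against functions that do not move with m. This
  dictates the splitting: u_m - u_inf is multiplied by F along the limit trajectory, whereas u_m
  multiplies F(x_m) - F(y), which Gronwall absorbs. The price is a Gronwall rate that involves |u_m|
  and is therefore merely square-integrable, controlled through its L2 norm alone. The same kind of
  L2 bound makes the integrals equicontinuous in t, with modulus a multiple of sqrt |t' - t|. The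
  continuous dependence of y on \<theta> comes from the same stability estimate, applied to two
  parameters and one control. Trajectories satisfy their equation only almost everywhere, so the
  passage to the integral equation is the fundamental theorem of calculus for absolutely continuous
  functions. It is proved for the gauge integral, where the exceptional null set is handled through
  the choice of the gauge.\<close>

lemma abs_continuous_on_subset:
  assumes "abs_continuous_on I f" "J \<subseteq> I"
  shows "abs_continuous_on J f"
  unfolding abs_continuous_on_def
proof (intro allI impI)
  fix e :: real assume "e > 0"
  then obtain d where d: "d > 0"
    "\<And>S. finite S \<and> (\<forall>(a, b)\<in>S. a \<le> b \<and> {a..b} \<subseteq> I) \<and>
        disjoint_family_on (\<lambda>(a, b). {a<..<b}) S \<and> (\<Sum>(a, b)\<in>S. b - a) < d \<Longrightarrow>
        (\<Sum>(a, b)\<in>S. norm (f b - f a)) < e"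
    using assms(1) unfolding abs_continuous_on_def by auto
  show "\<exists>d>0. \<forall>S. finite S \<and> (\<forall>(a, b)\<in>S. a \<le> b \<and> {a..b} \<subseteq> J) \<and>
        disjoint_family_on (\<lambda>(a, b). {a<..<b}) S \<and> (\<Sum>(a, b)\<in>S. b - a) < d \<longrightarrow>
        (\<Sum>(a, b)\<in>S. norm (f b - f a)) < e"
  proof (intro exI conjI allI impI)
    show "d > 0" by (rule d)
  next
    fix S :: "(real \<times> real) set"
    assume S: "finite S \<and> (\<forall>(a, b)\<in>S. a \<le> b \<and> {a..b} \<subseteq> J) \<and>
        disjoint_family_on (\<lambda>(a, b). {a<..<b}) S \<and> (\<Sum>(a, b)\<in>S. b - a) < d"
    then have "\<forall>(a, b)\<in>S. a \<le> b \<and> {a..b} \<subseteq> I"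
      using assms(2) by blast
    then show "(\<Sum>(a, b)\<in>S. norm (f b - f a)) < e"
      using S d(2) by blast
  qed
qed

lemma abs_continuous_on_imp_continuous_on:
  assumes "abs_continuous_on {a..b} f"
  shows "continuous_on {a..b} f"
  unfolding continuous_on_iff
proof (intro ballI allI impI)
  fix x e :: real
  assume x: "x \<in> {a..b}" and "e > 0"
  obtain d where d: "d > 0"
    "\<And>S. finite S \<Longrightarrow> (\<forall>(a', b')\<in>S. a' \<le> b' \<and> {a'..b'} \<subseteq> {a..b}) \<Longrightarrow>
        disjoint_family_on (\<lambda>(a, b). {a<..<b}) S \<Longrightarrow> (\<Sum>(a, b)\<in>S. b - a) < d \<Longrightarrow>
        (\<Sum>(a, b)\<in>S. norm (f b - f a)) < e"
    using assms \<open>e > 0\<close> unfolding abs_continuous_on_def by auto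
  have d1: "norm (f (max x y) - f (min x y)) < e" if "y \<in> {a..b}" "dist y x < d" for y
    using d(2)[of "{(min x y, max x y)}"] x that
    by (auto simp: disjoint_family_on_def dist_real_def max_def min_def split: if_splits)
  then have "dist (f y) (f x) < e" if "y \<in> {a..b}" "dist y x < d" for y
    using d1[OF that] by (auto simp: max_def min_def dist_norm norm_minus_commute split: if_splits)
  with d(1) show "\<exists>d>0. \<forall>y\<in>{a..b}. dist y x < d \<longrightarrow> dist (f y) (f x) < e"
    by blast
qed

lemma tagged_division_interval:
  fixes a b :: real
  assumes "p tagged_division_of {a..b}" "(x, K) \<in> p"
  shows "x \<in> K" "K = {Inf K..Sup K}" "Inf K \<le> Sup K" "K \<subseteq> {a..b}"
proof -
  show x: "x \<in> K" and "K \<subseteq> {a..b}"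
    using tagged_division_ofD(2,3)[OF assms] by auto
  obtain u v where K: "K = cbox u v"
    using tagged_division_ofD(4)[OF assms] by blast
  with x have "u \<le> v" by simp
  then show "K = {Inf K..Sup K}" "Inf K \<le> Sup K"
    by (simp_all add: K)
qed

text \<open>Absolute continuity speaks of sets of endpoint pairs, gauge integration of sets of
  tagged intervals; this translates the one into the other. It is stated for subsets
  \<open>q\<close> of a division because only the intervals tagged in a null set will be estimated
  this way.\<close>

lemma abs_continuous_on_tagged_division:
  assumes "abs_continuous_on {a..b} f" "e > 0"
  obtains d where "d > 0"
    "\<forall>p q. p tagged_division_of {a..b} \<longrightarrow> q \<subseteq> p \<longrightarrow> (\<Sum>(x,K)\<in>q. Sup K - Inf K) < d \<longrightarrow>
       (\<Sum>(x,K)\<in>q. norm (f (Sup K) - f (Inf K))) < e"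
proof -
  obtain d where d: "d > 0"
    "\<And>S. finite S \<Longrightarrow> (\<forall>(a', b')\<in>S. a' \<le> b' \<and> {a'..b'} \<subseteq> {a..b}) \<Longrightarrow>
        disjoint_family_on (\<lambda>(a, b). {a<..<b}) S \<Longrightarrow> (\<Sum>(a, b)\<in>S. b - a) < d \<Longrightarrow>
        (\<Sum>(a, b)\<in>S. norm (f b - f a)) < e"
    using assms unfolding abs_continuous_on_def by auto
  show ?thesis
  proof (rule that[OF d(1)], intro allI impI)
    fix p q :: "(real \<times> real set) set"
    assume p: "p tagged_division_of {a..b}" and q: "q \<subseteq> p"
      and small: "(\<Sum>(x,K)\<in>q. Sup K - Inf K) < d"
    define h where "h = (\<lambda>(x::real, K::real set). (Inf K, Sup K))"
    have "finite q"
      using p q finite_subset tagged_division_of_finite by blast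
    have K: "x \<in> K" "K = {Inf K..Sup K}" "Inf K \<le> Sup K" "K \<subseteq> {a..b}" "interior K = {Inf K<..<Sup K}"
      if "(x, K) \<in> q" for x K
    proof -
      have xK: "(x, K) \<in> p" using that q by blast
      show *: "x \<in> K" "K = {Inf K..Sup K}" "Inf K \<le> Sup K" "K \<subseteq> {a..b}"
        by (rule tagged_division_interval[OF p xK])+
      show "interior K = {Inf K<..<Sup K}"
        by (subst *(2)) simp
    qed
    have disj: "interior K1 \<inter> interior K2 = {}" if "(x1, K1) \<in> q" "(x2, K2) \<in> q" "(x1, K1) \<noteq> (x2, K2)"
      for x1 K1 x2 K2
      using tagged_division_ofD(5)[OF p] q that by blast
    \<comment> \<open>\<open>h\<close> forgets the tag, so sums over \<open>q\<close> reindex only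
      if no interval occurs under two tags. Two such occurrences have disjoint interiors, so the
      interval is a single point, and the tags, lying in it, agree.\<close>
    have inj: "inj_on h q"
    proof (rule inj_onI, clarify)
      fix x1 K1 x2 K2
      assume q1: "(x1, K1) \<in> q" and q2: "(x2, K2) \<in> q" and eq: "h (x1, K1) = h (x2, K2)"
      then have "K1 = K2"
        using K(2)[OF q1] K(2)[OF q2] by (simp add: h_def)
      moreover have "x1 = x2"
      proof (rule ccontr)
        assume "x1 \<noteq> x2"
        then have "{Inf K1<..<Sup K1} = {}"
          using disj[OF q1 q2] K(5)[OF q1] \<open>K1 = K2\<close> by auto
        then have "Inf K1 = Sup K1"
          using K(3)[OF q1] by auto
        then have "K1 = {Inf K1}"
          using K(2)[OF q1] by (metis atLeastAtMost_singleton)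
        then show False
          using K(1)[OF q1] K(1)[OF q2] \<open>K1 = K2\<close> \<open>x1 \<noteq> x2\<close> by (metis singletonD)
      qed
      ultimately show "x1 = x2 \<and> K1 = K2" by simp
    qed
    have "(\<Sum>(a, b)\<in>h ` q. norm (f b - f a)) < e"
    proof (rule d(2))
      show "finite (h ` q)"
        using \<open>finite q\<close> by simp
      show "\<forall>(a', b')\<in>h ` q. a' \<le> b' \<and> {a'..b'} \<subseteq> {a..b}"
      proof (clarsimp simp: h_def)
        fix x K assume xK: "(x, K) \<in> q"
        show "Inf K \<le> Sup K \<and> (Inf K \<le> Sup K \<longrightarrow> a \<le> Inf K \<and> Sup K \<le> b)"
          using K(2-4)[OF xK] by (metis atLeastatMost_subset_iff)
      qed
      show "disjoint_family_on (\<lambda>(a, b). {a<..<b}) (h ` q)"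
        unfolding disjoint_family_on_def
      proof (intro ballI impI)
        fix s t
        assume "s \<in> h ` q" "t \<in> h ` q" "s \<noteq> t"
        then obtain x1 K1 x2 K2 where *: "(x1, K1) \<in> q" "(x2, K2) \<in> q" "(x1, K1) \<noteq> (x2, K2)"
          "s = (Inf K1, Sup K1)" "t = (Inf K2, Sup K2)"
          by (auto simp: h_def)
        show "(case s of (a, b) \<Rightarrow> {a<..<b}) \<inter> (case t of (a, b) \<Rightarrow> {a<..<b}) = {}"
          using disj[OF *(1-3)] unfolding K(5)[OF *(1)] K(5)[OF *(2)] *(4,5) prod.case .
      qed
      show "(\<Sum>(a, b)\<in>h ` q. b - a) < d"
        using small by (simp only: sum.reindex[OF inj] o_def) (simp only: h_def case_prod_unfold fst_conv snd_conv)
    qed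
    then show "(\<Sum>(x,K)\<in>q. norm (f (Sup K) - f (Inf K))) < e"
      by (simp only: sum.reindex[OF inj] o_def) (simp only: h_def case_prod_unfold fst_conv snd_conv)
  qed
qed

text \<open>Where the derivative may fail to exist, the gauge confines the intervals to an open set of
  small measure, and absolute continuity makes their total contribution small.\<close>

theorem abs_continuous_on_has_integral_derivative:
  fixes f :: "real \<Rightarrow> 'a::banach"
  assumes "a \<le> b" and ac: "abs_continuous_on {a..b} f" and N: "negligible N"
    and deriv: "\<And>x. x \<in> {a..b} - N \<Longrightarrow> (f has_vector_derivative f' x) (at x within {a..b})"
  shows "(f' has_integral (f b - f a)) {a..b}"
proof (cases "a = b")
  case True
  then show ?thesis using has_integral_refl(2)[of f' a] by simp
next
  case False
  \<comment> \<open>The value \<open>0\<close> on \<open>N\<close> removes the terms tagged in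
    \<open>N\<close> from the Riemann sums; as \<open>N\<close> is negligible, the integral is that
    of \<open>f'\<close>.\<close>
  define g where "g x = (if x \<in> N then 0 else f' x)" for x
  have "(g has_integral (f b - f a)) {a..b}"
    unfolding has_integral_factor_content_real
  proof (intro allI impI)
    fix e :: real
    assume "e > 0"
    \<comment> \<open>Half of the error is allotted to the intervals tagged in \<open>N\<close>,
      half to the others.\<close>
    define e' where "e' = e / 2"
    have "e' > 0" using \<open>e > 0\<close> by (simp add: e'_def)
    have eb: "e' * (b - a) > 0" using False \<open>a \<le> b\<close> \<open>e' > 0\<close> by simp
    obtain \<delta> where \<delta>: "\<delta> > 0"
      "\<forall>p q. p tagged_division_of {a..b} \<longrightarrow> q \<subseteq> p \<longrightarrow> (\<Sum>(x,K)\<in>q. Sup K - Inf K) < \<delta> \<longrightarrow>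
         (\<Sum>(x,K)\<in>q. norm (f (Sup K) - f (Inf K))) < e' * (b - a)"
      by (rule abs_continuous_on_tagged_division[OF ac eb])
    have N_meas: "N \<in> sets lebesgue"
      using N by (rule negligible_imp_sets)
    obtain T where T: "open T" "N \<subseteq> T" "T - N \<in> lmeasurable" "emeasure lebesgue (T - N) < ennreal \<delta>"
      by (rule sets_lebesgue_outer_open[OF N_meas \<open>\<delta> > 0\<close>])
    have T_meas: "T \<in> lmeasurable" "measure lebesgue T < \<delta>"
    proof -
      have "T = (T - N) \<union> N" using T(2) by auto
      moreover have "N \<in> null_sets lebesgue"
        using N by (simp add: negligible_iff_null_sets)
      ultimately have eq: "emeasure lebesgue T = emeasure lebesgue (T - N)"
        using T(3) by (metis emeasure_Un_null_set fmeasurableD)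
      then show *: "T \<in> lmeasurable"
        using T by (intro fmeasurableI) (auto simp: borel_open order.strict_trans)
      show "measure lebesgue T < \<delta>"
        using T(4) eq * \<delta>(1) by (metis emeasure_eq_measure2 ennreal_less_iff measure_nonneg)
    qed
    have "\<exists>d>0. x \<in> {a..b} - N \<longrightarrow>
         (\<forall>y\<in>{a..b}. norm (y-x) < d \<longrightarrow> norm (f y - f x - (y-x) *\<^sub>R f' x) \<le> e' * norm (y-x))" for x
      using deriv[of x] \<open>e' > 0\<close> unfolding has_vector_derivative_def has_derivative_within_alt
      by (cases "x \<in> {a..b} - N") (blast, auto intro: exI[of _ 1])
    then obtain d where d: "\<And>x. 0 < d x"
      "\<And>x y. \<lbrakk>x \<in> {a..b} - N; y \<in> {a..b}; norm (y-x) < d x\<rbrakk>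
                        \<Longrightarrow> norm (f y - f x - (y-x) *\<^sub>R f' x) \<le> e' * norm (y-x)"
      by metis
    define \<gamma> where "\<gamma> x = (if x \<in> N then T else ball x (d x))" for x
    have "gauge \<gamma>"
      using T d(1) by (auto simp: gauge_def \<gamma>_def)
    moreover have "norm ((\<Sum>(x,K)\<in>p. measure lborel K *\<^sub>R g x) - (f b - f a)) \<le> e * measure lborel {a..b}"
      if p: "p tagged_division_of {a..b}" and fine: "\<gamma> fine p" for p
    proof -
      define q where "q = {(x, K) \<in> p. x \<in> N}"
      have fin: "finite p" and "q \<subseteq> p"
        using p by (auto simp: q_def)
      have fb: "f b - f a = (\<Sum>(x,K)\<in>p. f (Sup K) - f (Inf K))"
        and ba: "b - a = (\<Sum>(x,K)\<in>p. Sup K - Inf K)"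
        using additive_tagged_division_1[OF \<open>a \<le> b\<close> p, of f]
          additive_tagged_division_1[OF \<open>a \<le> b\<close> p, of "\<lambda>x. x"] by auto
      note K = tagged_division_interval[OF p]
      have "norm ((\<Sum>(x,K)\<in>p. measure lborel K *\<^sub>R g x) - (f b - f a))
          = norm (\<Sum>(x,K)\<in>p. measure lborel K *\<^sub>R g x - (f (Sup K) - f (Inf K)))"
        by (simp add: fb sum_subtractf case_prod_unfold)
      also have "\<dots> \<le> (\<Sum>(x,K)\<in>p. norm (measure lborel K *\<^sub>R g x - (f (Sup K) - f (Inf K))))"
        by (rule order_trans[OF norm_sum]) (simp add: case_prod_unfold)
      also have "\<dots> = (\<Sum>(x,K)\<in>p-q. norm (measure lborel K *\<^sub>R g x - (f (Sup K) - f (Inf K)))) +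
          (\<Sum>(x,K)\<in>q. norm (measure lborel K *\<^sub>R g x - (f (Sup K) - f (Inf K))))"
        by (rule sum.subset_diff[OF \<open>q \<subseteq> p\<close> fin])
      also have "(\<Sum>(x,K)\<in>q. norm (measure lborel K *\<^sub>R g x - (f (Sup K) - f (Inf K))))
          = (\<Sum>(x,K)\<in>q. norm (f (Sup K) - f (Inf K)))"
        by (rule sum.cong) (auto simp: q_def g_def norm_minus_commute)
      also have "\<dots> \<le> e' * (b - a)"
      proof -
        \<comment> \<open>The intervals in \<open>q\<close> overlap only in null sets, so their
          lengths add up to the measure of their union, which the gauge keeps inside
          \<open>T\<close>.\<close>
        have "(\<Sum>(x,K)\<in>q. Sup K - Inf K) = (\<Sum>z\<in>q. measure lebesgue (snd z))"
        proof (rule sum.cong[OF refl], clarify)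
          fix x K assume "(x, K) \<in> q"
          then have xK: "(x, K) \<in> p" using \<open>q \<subseteq> p\<close> by blast
          have "measure lebesgue K = measure lebesgue {Inf K..Sup K}" using K(2)[OF xK] by simp
          then show "Sup K - Inf K = measure lebesgue (snd (x, K))" using K(3)[OF xK] by simp
        qed
        also have "\<dots> = measure lebesgue (\<Union>(snd ` q))"
        proof (rule measure_negligible_finite_Union_image[symmetric])
          show "finite q" using fin \<open>q \<subseteq> p\<close> finite_subset by blast
          show "snd z \<in> lmeasurable" if "z \<in> q" for z
            using K(2)[of "fst z" "snd z"] that \<open>q \<subseteq> p\<close>
            by (metis lmeasurable_interval(1) box_real(2) lmeasurable_cbox prod.collapse subsetD)
          show "pairwise (\<lambda>y z. negligible (snd y \<inter> snd z)) q"
          proof (rule pairwiseI)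
            fix y z assume yz: "y \<in> q" "z \<in> q" "y \<noteq> z"
            then have "interior (snd y) \<inter> interior (snd z) = {}"
              using tagged_division_ofD(5)[OF p, of "fst y" "snd y" "fst z" "snd z"] \<open>q \<subseteq> p\<close>
              by (auto simp: prod_eq_iff)
            moreover have "convex (snd y)" "convex (snd z)"
              using yz K(2)[of "fst y" "snd y"] K(2)[of "fst z" "snd z"] \<open>q \<subseteq> p\<close>
              by (metis convex_real_interval(5) prod.collapse subsetD)+
            ultimately show "negligible (snd y \<inter> snd z)"
              by (simp add: convex_Int negligible_convex_interior)
          qed
        qed
        also have "\<dots> \<le> measure lebesgue T"
        proof (rule measure_mono_fmeasurable)
          show "\<Union>(snd ` q) \<subseteq> T"
            using fine by (fastforce simp: q_def fine_def \<gamma>_def)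
          show "T \<in> lmeasurable" by (rule T_meas)
          have "snd z \<in> sets lebesgue" if "z \<in> q" for z
            using K(2)[of "fst z" "snd z"] that \<open>q \<subseteq> p\<close>
            by (metis box_real(2) lmeasurable_cbox fmeasurableD prod.collapse subsetD)
          then show "\<Union>(snd ` q) \<in> sets lebesgue"
            using finite_subset[OF \<open>q \<subseteq> p\<close> fin] by (intro sets.finite_Union) auto
        qed
        also have "\<dots> < \<delta>" by (rule T_meas)
        finally show ?thesis
          using \<delta>(2)[rule_format, OF p \<open>q \<subseteq> p\<close>] by simp
      qed
      also have "(\<Sum>(x,K)\<in>p-q. norm (measure lborel K *\<^sub>R g x - (f (Sup K) - f (Inf K))))
          \<le> (\<Sum>(x,K)\<in>p-q. e' * (Sup K - Inf K))"
      proof (rule sum_mono, clarify)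
        fix x K assume xK: "(x, K) \<in> p" "(x, K) \<notin> q"
        then have "x \<notin> N" by (simp add: q_def)
        define u v where "u = Inf K" and "v = Sup K"
        have Kuv: "x \<in> K" "K = {u..v}" "u \<le> v" "K \<subseteq> {a..b}"
          unfolding u_def v_def using K[OF xK(1)] by blast+
        have ball: "K \<subseteq> ball x (d x)"
          using fineD[OF fine xK(1)] \<open>x \<notin> N\<close> by (simp add: \<gamma>_def)
        have uvK: "u \<in> K" "v \<in> K" "x \<in> {a..b} - N"
          using Kuv \<open>x \<notin> N\<close> by auto
        have D: "norm (f y - f x - (y - x) *\<^sub>R f' x) \<le> e' * norm (y - x)" if "y \<in> K" for y
          using that ball Kuv(4) uvK(3) by (intro d(2)) (auto simp: dist_norm norm_minus_commute)
        \<comment> \<open>The tag lies between the endpoints, so the two one-sided errors, with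
          factors \<open>norm (u - x)\<close> and \<open>norm (v - x)\<close>, add up to exactly
          \<open>e' * (v - u)\<close>.\<close>
        have "norm ((v - u) *\<^sub>R f' x - (f v - f u))
            = norm ((f u - f x - (u - x) *\<^sub>R f' x) - (f v - f x - (v - x) *\<^sub>R f' x))"
          by (simp add: algebra_simps)
        also have "\<dots> \<le> e' * norm (u - x) + e' * norm (v - x)"
          by (rule order_trans[OF norm_triangle_ineq4 add_mono[OF D D]]) (use uvK in auto)
        also have "\<dots> = e' * (v - u)"
          using Kuv(1) unfolding Kuv(2) by (simp add: algebra_simps)
        also have "v - u = measure lborel K"
          using Kuv(3) by (subst Kuv(2)) simp
        finally show "norm (measure lborel K *\<^sub>R g x - (f (Sup K) - f (Inf K))) \<le> e' * (Sup K - Inf K)"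
          using \<open>x \<notin> N\<close> \<open>v - u = measure lborel K\<close> by (simp add: g_def flip: u_def v_def)
      qed
      also have "(\<Sum>(x,K)\<in>p-q. e' * (Sup K - Inf K)) \<le> (\<Sum>(x,K)\<in>p. e' * (Sup K - Inf K))"
        using K(3) \<open>e' > 0\<close> fin by (intro sum_mono2) auto
      also have "\<dots> = e' * (b - a)"
        unfolding ba sum_distrib_left by (simp add: case_prod_unfold)
      finally show ?thesis
        using \<open>a \<le> b\<close> by (simp add: e'_def field_simps)
    qed
    ultimately show "\<exists>\<gamma>. gauge \<gamma> \<and> (\<forall>p. p tagged_division_of {a..b} \<and> \<gamma> fine p \<longrightarrow>
        norm ((\<Sum>(x,K)\<in>p. measure lborel K *\<^sub>R g x) - (f b - f a)) \<le> e * measure lborel {a..b})"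
      by (intro exI[of _ \<gamma>]) simp
  qed
  then show ?thesis
    by (rule has_integral_spike[OF N, rotated]) (simp add: g_def)
qed

text \<open>Lets every integral up to time \<open>t\<close> be written over the whole interval with
  a cut-off, so that all estimates take place in one fixed L2 space.\<close>

lemma LINT_lebesgue_on_indicator:
  fixes g :: "'a::euclidean_space \<Rightarrow> 'b::euclidean_space"
  assumes g: "integrable (lebesgue_on T) g"
    and S: "S \<in> sets lebesgue" "S \<subseteq> T" "T \<in> sets lebesgue"
  shows "integrable (lebesgue_on S) g"
    and "(LINT x|lebesgue_on S. g x) = (LINT x|lebesgue_on T. indicator S x *\<^sub>R g x)"
proof -
  have ind: "indicat_real S x *\<^sub>R g x = indicat_real S x *\<^sub>R (indicat_real T x *\<^sub>R g x)"
    "indicat_real S x *\<^sub>R g x = indicat_real T x *\<^sub>R (indicat_real S x *\<^sub>R g x)" for x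
    using S by (auto simp: indicator_def)
  have *: "integrable lebesgue (\<lambda>x. indicator T x *\<^sub>R g x)"
    using g S by (simp add: integrable_restrict_space)
  have "integrable lebesgue (\<lambda>x. indicator S x *\<^sub>R g x)"
    unfolding ind(1) by (rule integrable_mult_indicator[OF _ *]) (use S in simp)
  then show "integrable (lebesgue_on S) g"
    using S by (simp add: integrable_restrict_space)
  have "(LINT x|lebesgue_on S. g x) = (LINT x|lebesgue. indicator S x *\<^sub>R g x)"
    using S by (simp add: integral_restrict_space)
  also have "\<dots> = (LINT x|lebesgue_on T. indicator S x *\<^sub>R g x)"
    using S by (subst ind(2)) (simp add: integral_restrict_space)
  finally show "(LINT x|lebesgue_on S. g x) = (LINT x|lebesgue_on T. indicator S x *\<^sub>R g x)" .
qed

text \<open>The Lebesgue integral of an integrable function is also its gauge integral, so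
  uniqueness of the latter turns the theorem above into a statement about
  \<open>LINT\<close>.\<close>

lemma abs_continuous_on_LINT_derivative:
  fixes f :: "real \<Rightarrow> 'a::euclidean_space"
  assumes ac: "abs_continuous_on {a..b} f"
    and deriv: "AE x in lebesgue_on {a..b}. (f has_vector_derivative g x) (at x within {a..b})"
    and g: "integrable (lebesgue_on {a..b}) g" and t: "t \<in> {a..b}"
  shows "f t - f a = (LINT x|lebesgue_on {a..b}. indicator {a..t} x *\<^sub>R g x)"
proof -
  obtain N where N: "N \<in> null_sets (lebesgue_on {a..b})"
    "{x \<in> space (lebesgue_on {a..b}). \<not> (f has_vector_derivative g x) (at x within {a..b})} \<subseteq> N"
    using deriv unfolding eventually_ae_filter by auto
  then have "negligible N"
    by (simp add: negligible_iff_null_sets null_sets_restrict_space)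
  have "(g has_integral (f t - f a)) {a..t}"
  proof (rule abs_continuous_on_has_integral_derivative[OF _ _ \<open>negligible N\<close>])
    show "abs_continuous_on {a..t} f"
      using t by (intro abs_continuous_on_subset[OF ac]) auto
    show "(f has_vector_derivative g x) (at x within {a..t})" if "x \<in> {a..t} - N" for x
    proof (rule has_vector_derivative_within_subset)
      show "(f has_vector_derivative g x) (at x within {a..b})"
        using that N(2) t by auto
    qed (use t in auto)
  qed (use t in auto)
  moreover have "integrable (lebesgue_on {a..t}) g"
    using LINT_lebesgue_on_indicator(1)[OF g, of "{a..t}"] t by simp
  then have "(g has_integral (LINT x|lebesgue_on {a..t}. g x)) {a..t}"
    by (rule has_integral_integral_lebesgue_on) simp
  ultimately have "f t - f a = (LINT x|lebesgue_on {a..t}. g x)"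
    by (rule has_integral_unique)
  also have "\<dots> = (LINT x|lebesgue_on {a..b}. indicator {a..t} x *\<^sub>R g x)"
    using LINT_lebesgue_on_indicator(2)[OF g, of "{a..t}"] t by simp
  finally show ?thesis .
qed

section \<open>Square-integrable functions\<close>

text \<open>\<open>L2_controls\<close> for an arbitrary measure and Euclidean codomain: besides
  controls, it has to cover real-valued rates, cut-offs and exponential weights.\<close>

definition square_integrable :: "'a measure \<Rightarrow> ('a \<Rightarrow> 'b::euclidean_space) \<Rightarrow> bool" where
  "square_integrable M u \<longleftrightarrow> u \<in> borel_measurable M \<and> integrable M (\<lambda>x. (norm (u x))\<^sup>2)"

text \<open>A non-integrable function has Bochner integral \<open>0\<close>, so this is the L2 norm
  only for functions that are \<open>square_integrable\<close>.\<close>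

definition L2_norm :: "'a measure \<Rightarrow> ('a \<Rightarrow> 'b::euclidean_space) \<Rightarrow> real" where
  "L2_norm M u = sqrt (LINT x|M. (norm (u x))\<^sup>2)"

lemma L2_norm_nonneg: "0 \<le> L2_norm M u"
  by (simp add: L2_norm_def)

lemma L2_norm_power2: "(L2_norm M u)\<^sup>2 = (LINT x|M. (norm (u x))\<^sup>2)"
  by (simp add: L2_norm_def)

lemma square_integrable_measurable: "square_integrable M u \<Longrightarrow> u \<in> borel_measurable M"
  by (simp add: square_integrable_def)

lemma square_integrable_integrable_power2:
  "square_integrable M u \<Longrightarrow> integrable M (\<lambda>x. (norm (u x))\<^sup>2)"
  by (simp add: square_integrable_def)

lemma square_integrable_bound:
  assumes "square_integrable M u" "v \<in> borel_measurable M" "AE x in M. norm (v x) \<le> C * norm (u x)"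
  shows "square_integrable M v"
  unfolding square_integrable_def
proof
  show "integrable M (\<lambda>x. (norm (v x))\<^sup>2)"
  proof (rule Bochner_Integration.integrable_bound)
    show "integrable M (\<lambda>x. C\<^sup>2 * (norm (u x))\<^sup>2)"
      using assms(1) by (simp add: square_integrable_def)
    show "AE x in M. norm ((norm (v x))\<^sup>2) \<le> norm (C\<^sup>2 * (norm (u x))\<^sup>2)"
      using assms(3) by eventually_elim (simp add: power_mono flip: power_mult_distrib)
    show "(\<lambda>x. (norm (v x))\<^sup>2) \<in> borel_measurable M"
      using assms(2) by simp
  qed
qed (rule assms)

lemma square_integrable_norm: "square_integrable M u \<Longrightarrow> square_integrable M (\<lambda>x. norm (u x))"
  by (auto simp: square_integrable_def)

lemma square_integrable_scaleR: "square_integrable M u \<Longrightarrow> square_integrable M (\<lambda>x. c *\<^sub>R u x)"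
  by (rule square_integrable_bound[where C="\<bar>c\<bar>" and u=u]) (auto simp: square_integrable_def)

lemma square_integrable_indicator:
  assumes "square_integrable M u" "S \<in> sets M"
  shows "square_integrable M (\<lambda>x. indicator S x *\<^sub>R u x)"
proof (rule square_integrable_bound[OF assms(1), where C=1])
  show "(\<lambda>x. indicator S x *\<^sub>R u x) \<in> borel_measurable M"
    using assms by (intro borel_measurable_scaleR borel_measurable_indicator square_integrable_measurable)
qed (simp add: indicator_def)

lemma square_integrable_add:
  assumes "square_integrable M u" "square_integrable M v"
  shows "square_integrable M (\<lambda>x. u x + v x)"
  unfolding square_integrable_def
proof
  show m: "(\<lambda>x. u x + v x) \<in> borel_measurable M"
    using assms by (auto simp: square_integrable_def)
  show "integrable M (\<lambda>x. (norm (u x + v x))\<^sup>2)"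
  proof (rule Bochner_Integration.integrable_bound)
    show "integrable M (\<lambda>x. 2 * (norm (u x))\<^sup>2 + 2 * (norm (v x))\<^sup>2)"
      using assms by (simp add: square_integrable_def)
    show "(\<lambda>x. (norm (u x + v x))\<^sup>2) \<in> borel_measurable M"
      using m by simp
    have "(norm (u x + v x))\<^sup>2 \<le> (norm (u x) + norm (v x))\<^sup>2" for x
      by (simp add: norm_triangle_ineq power_mono)
    also have "(norm (u x) + norm (v x))\<^sup>2 \<le> 2 * (norm (u x))\<^sup>2 + 2 * (norm (v x))\<^sup>2" for x
      using zero_le_power2[of "norm (u x) - norm (v x)"] by (simp add: power2_eq_square algebra_simps)
    finally show "AE x in M. norm ((norm (u x + v x))\<^sup>2) \<le> norm (2 * (norm (u x))\<^sup>2 + 2 * (norm (v x))\<^sup>2)"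
      by simp
  qed
qed

lemma square_integrable_diff:
  assumes "square_integrable M u" "square_integrable M v"
  shows "square_integrable M (\<lambda>x. u x - v x)"
  using square_integrable_add[OF assms(1) square_integrable_scaleR[OF assms(2), of "-1"]] by simp

lemma L2_norm_scaleR: "L2_norm M (\<lambda>x. c *\<^sub>R u x) = \<bar>c\<bar> * L2_norm M u"
  by (simp add: L2_norm_def power_mult_distrib real_sqrt_mult)

lemma nn_integral_norm_power2:
  "square_integrable M u \<Longrightarrow> (\<integral>\<^sup>+x. (ennreal (norm (u x)))\<^sup>2 \<partial>M) = ennreal ((L2_norm M u)\<^sup>2)"
  by (simp add: L2_norm_power2 square_integrable_def ennreal_power nn_integral_eq_integral)

text \<open>Integrability comes from \<open>a * b \<le> a\<^sup>2 + b\<^sup>2\<close> for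
  nonnegative reals, the inequality from its version for extended nonnegative integrals. A product
  of norms, rather than an inner product, also serves scalar-times-vector integrands.\<close>

lemma L2_Cauchy_Schwarz:
  assumes u: "square_integrable M u" and v: "square_integrable M v"
  shows "integrable M (\<lambda>x. norm (u x) * norm (v x))"
    and "(LINT x|M. norm (u x) * norm (v x)) \<le> L2_norm M u * L2_norm M v"
proof -
  have [measurable]: "u \<in> borel_measurable M" "v \<in> borel_measurable M"
    using u v by (auto simp: square_integrable_def)
  show int: "integrable M (\<lambda>x. norm (u x) * norm (v x))"
  proof (rule Bochner_Integration.integrable_bound)
    show "integrable M (\<lambda>x. (norm (u x))\<^sup>2 + (norm (v x))\<^sup>2)"
      using assms by (simp add: square_integrable_def)
    have "norm (u x) * norm (v x) \<le> (norm (u x))\<^sup>2 + (norm (v x))\<^sup>2" for x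
      using sum_squares_bound[of "norm (u x)" "norm (v x)"]
        mult_nonneg_nonneg[OF norm_ge_zero[of "u x"] norm_ge_zero[of "v x"]] by linarith
    then show "AE x in M. norm (norm (u x) * norm (v x)) \<le> norm ((norm (u x))\<^sup>2 + (norm (v x))\<^sup>2)"
      by simp
  qed simp
  have "(\<integral>\<^sup>+x. ennreal (norm (u x)) * ennreal (norm (v x)) \<partial>M)\<^sup>2 \<le>
     (\<integral>\<^sup>+x. (ennreal (norm (u x)))\<^sup>2 \<partial>M) * (\<integral>\<^sup>+x. (ennreal (norm (v x)))\<^sup>2 \<partial>M)"
    by (rule Cauchy_Schwarz_nn_integral) auto
  also have "(\<integral>\<^sup>+x. ennreal (norm (u x)) * ennreal (norm (v x)) \<partial>M)
      = ennreal (LINT x|M. norm (u x) * norm (v x))"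
    using int by (simp add: nn_integral_eq_integral flip: ennreal_mult)
  finally have "(LINT x|M. norm (u x) * norm (v x))\<^sup>2 \<le> (L2_norm M u * L2_norm M v)\<^sup>2"
    unfolding nn_integral_norm_power2[OF u] nn_integral_norm_power2[OF v]
    by (simp add: ennreal_power power_mult_distrib flip: ennreal_mult)
  then show "(LINT x|M. norm (u x) * norm (v x)) \<le> L2_norm M u * L2_norm M v"
    by (rule power2_le_imp_le) (simp add: L2_norm_nonneg)
qed

lemma L2_inner_integrable:
  assumes u: "square_integrable M u" and v: "square_integrable M v"
  shows "integrable M (\<lambda>x. u x \<bullet> v x)"
    and "(LINT x|M. norm (u x \<bullet> v x)) \<le> L2_norm M u * L2_norm M v"
proof -
  have [measurable]: "u \<in> borel_measurable M" "v \<in> borel_measurable M"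
    using u v by (auto simp: square_integrable_def)
  show *: "integrable M (\<lambda>x. u x \<bullet> v x)"
    by (rule Bochner_Integration.integrable_bound[OF L2_Cauchy_Schwarz(1)[OF assms]])
       (auto simp: Cauchy_Schwarz_ineq2)
  have "(LINT x|M. norm (u x \<bullet> v x)) \<le> (LINT x|M. norm (u x) * norm (v x))"
    using * L2_Cauchy_Schwarz(1)[OF assms] by (intro integral_mono) (auto simp: Cauchy_Schwarz_ineq2)
  also note L2_Cauchy_Schwarz(2)[OF assms]
  finally show "(LINT x|M. norm (u x \<bullet> v x)) \<le> L2_norm M u * L2_norm M v" .
qed

lemma L2_inner_le:
  assumes u: "square_integrable M u" and v: "square_integrable M v"
  shows "\<bar>LINT x|M. u x \<bullet> v x\<bar> \<le> L2_norm M u * L2_norm M v"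
  using order_trans[OF integral_norm_bound L2_inner_integrable(2)[OF assms]] by simp

section \<open>Uniform boundedness in \<open>L\<^sup>2\<close>\<close>

lemma L2_inner_self: "(LINT x|M. u x \<bullet> u x) = (L2_norm M u)\<^sup>2"
  by (simp add: L2_norm_power2 power2_norm_eq_inner)

text \<open>Sum and integral may be exchanged in \<open>ennreal\<close>; the integral of the series
  is then finite, which forces the series to be finite almost everywhere.\<close>

lemma AE_summable_of_summable_integral:
  fixes f :: "nat \<Rightarrow> 'a \<Rightarrow> real"
  assumes int: "\<And>i. integrable M (f i)" and nonneg: "\<And>i x. 0 \<le> f i x"
    and sum: "summable (\<lambda>i. LINT x|M. f i x)"
  shows "AE x in M. summable (\<lambda>i. f i x)" "integrable M (\<lambda>x. \<Sum>i. f i x)"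
proof -
  have [measurable]: "f i \<in> borel_measurable M" for i
    using int by auto
  have "(\<integral>\<^sup>+x. (\<Sum>i. ennreal (f i x)) \<partial>M) = (\<Sum>i. \<integral>\<^sup>+x. ennreal (f i x) \<partial>M)"
    by (rule nn_integral_suminf) simp
  also have "\<dots> = (\<Sum>i. ennreal (LINT x|M. f i x))"
    using int nonneg by (simp add: nn_integral_eq_integral)
  also have "\<dots> \<noteq> \<infinity>"
    using sum nonneg by (simp add: ennreal_suminf_neq_top)
  finally have "AE x in M. (\<Sum>i. ennreal (f i x)) \<noteq> \<infinity>"
    by (intro nn_integral_PInf_AE) simp_all
  then show *: "AE x in M. summable (\<lambda>i. f i x)"
    by eventually_elim (rule summable_suminf_not_top, use nonneg in auto)
  show "integrable M (\<lambda>x. \<Sum>i. f i x)"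
    by (rule integrable_suminf[OF int]) (use * sum nonneg in auto)
qed

text \<open>The weights \<open>2 ^ i\<close> turn \<open>L\<^sup>2\<close> summability into a pointwise
  Cauchy--Schwarz estimate, so that neither Minkowski's inequality nor completeness
  of \<open>L\<^sup>2\<close> is needed.\<close>

lemma square_integrable_suminf:
  fixes h :: "nat \<Rightarrow> 'a \<Rightarrow> 'b::euclidean_space"
  assumes h: "\<And>i. square_integrable M (h i)" and le: "\<And>i. L2_norm M (h i) \<le> (1/3) ^ i"
  shows "AE x in M. summable (\<lambda>i. norm (h i x))" "square_integrable M (\<lambda>x. \<Sum>i. h i x)"
proof -
  have [measurable]: "h i \<in> borel_measurable M" for i
    using h square_integrable_measurable by blast
  \<comment> \<open>In the integral, the weight \<open>2 ^ i\<close> is beaten by the squared norm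
    bound \<open>(1/9) ^ i\<close>, leaving the summable \<open>(2/9) ^ i\<close>.\<close>
  define G where "G i x = 2 ^ i * (norm (h i x))\<^sup>2" for i x
  have G: "integrable M (G i)" "0 \<le> G i x" for i x
    using h by (auto simp: G_def[abs_def] square_integrable_def)
  have "(LINT x|M. G i x) \<le> (2/9) ^ i" for i
  proof -
    have "(LINT x|M. G i x) = 2 ^ i * (L2_norm M (h i))\<^sup>2"
      by (simp add: G_def L2_norm_power2)
    also have "\<dots> \<le> 2 ^ i * ((1/3) ^ i)\<^sup>2"
      by (intro mult_left_mono power_mono le L2_norm_nonneg) auto
    also have "\<dots> = (2/9) ^ i"
      by (simp add: power2_eq_square flip: power_mult_distrib)
    finally show ?thesis .
  qed
  then have "summable (\<lambda>i. LINT x|M. G i x)"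
    by (intro summable_comparison_test'[OF summable_geometric[of "2/9"]]) (use G in auto)
  note GS = AE_summable_of_summable_integral[OF G this]
  show sum: "AE x in M. summable (\<lambda>i. norm (h i x))"
    using GS(1)
  proof eventually_elim
    case (elim x)
    have le: "norm (h i x) \<le> (1/2) ^ i + G i x" for i
    proof -
      \<comment> \<open>Expanding the square gives the inequality between arithmetic and geometric
        mean, \<open>2 * norm (h i x) \<le> (1/2) ^ i + G i x\<close>.\<close>
      have "0 \<le> (1/2) ^ i * (2 ^ i * norm (h i x) - 1)\<^sup>2"
        by simp
      also have "\<dots> = G i x - 2 * norm (h i x) + (1/2) ^ i"
        by (simp add: G_def power2_eq_square algebra_simps power_one_over)
      finally show ?thesis using norm_ge_zero[of "h i x"] by linarith
    qed
    have "summable (\<lambda>i. (1/2) ^ i + G i x)"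
      using elim by (intro summable_add summable_geometric) auto
    then show ?case
      by (rule summable_comparison_test'[where N=0]) (use le in auto)
  qed
  show "square_integrable M (\<lambda>x. \<Sum>i. h i x)"
    unfolding square_integrable_def
  proof
    show "(\<lambda>x. \<Sum>i. h i x) \<in> borel_measurable M"
      by simp
    show "integrable M (\<lambda>x. (norm (\<Sum>i. h i x))\<^sup>2)"
    proof (rule Bochner_Integration.integrable_bound)
      show "integrable M (\<lambda>x. 2 * (\<Sum>i. G i x))"
        using GS(2) by simp
      show "AE x in M. norm ((norm (\<Sum>i. h i x))\<^sup>2) \<le> norm (2 * (\<Sum>i. G i x))"
        using GS(1) sum
      proof eventually_elim
        case (elim x)
        have part: "(norm (\<Sum>i<n. h i x))\<^sup>2 \<le> 2 * (\<Sum>i. G i x)" for n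
        proof -
          have "norm (\<Sum>i<n. h i x) \<le> (\<Sum>i<n. norm (h i x))"
            by (rule norm_sum)
          \<comment> \<open>After Cauchy-Schwarz the factors \<open>(1/2) ^ i\<close> sum to at most
            2, the constant in the dominating function.\<close>
          also have "\<dots> = (\<Sum>i<n. sqrt ((1/2) ^ i) * sqrt (G i x))"
            by (intro sum.cong) (auto simp: G_def real_sqrt_mult[symmetric] power_one_over)
          finally have "(norm (\<Sum>i<n. h i x))\<^sup>2 \<le> (\<Sum>i<n. sqrt ((1/2) ^ i) * sqrt (G i x))\<^sup>2"
            by (intro power_mono) auto
          also have "\<dots> \<le> (\<Sum>i<n. (sqrt ((1/2) ^ i))\<^sup>2) * (\<Sum>i<n. (sqrt (G i x))\<^sup>2)"
            by (rule Cauchy_Schwarz_ineq_sum)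
          also have "\<dots> = (\<Sum>i<n. (1/2) ^ i) * (\<Sum>i<n. G i x)"
            using G(2) by simp
          also have "\<dots> \<le> 2 * (\<Sum>i. G i x)"
          proof (rule mult_mono)
            show "(\<Sum>i<n. (1/2::real) ^ i) \<le> 2"
              by (simp add: sum_gp_strict)
            show "(\<Sum>i<n. G i x) \<le> (\<Sum>i. G i x)"
              using elim(1) G(2) by (intro sum_le_suminf) auto
          qed (auto intro: sum_nonneg G)
          finally show ?thesis .
        qed
        have "(\<lambda>n. \<Sum>i<n. h i x) \<longlonglongrightarrow> (\<Sum>i. h i x)"
          by (rule summable_LIMSEQ[OF summable_norm_cancel[OF elim(2)]])
        then have "(\<lambda>n. (norm (\<Sum>i<n. h i x))\<^sup>2) \<longlonglongrightarrow> (norm (\<Sum>i. h i x))\<^sup>2"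
          by (intro tendsto_intros)
        then have "(norm (\<Sum>i. h i x))\<^sup>2 \<le> 2 * (\<Sum>i. G i x)"
          by (rule LIMSEQ_le_const2) (use part in auto)
        then show ?case
          by simp
      qed
    qed simp
  qed
qed

text \<open>Pairing with \<open>u\<close> commutes with the series because the integrals of the
  absolute pairings are dominated by the geometric \<open>L2_norm M u * (1/3) ^ i\<close>.\<close>

lemma L2_inner_suminf:
  fixes h :: "nat \<Rightarrow> 'a \<Rightarrow> 'b::euclidean_space"
  assumes h: "\<And>i. square_integrable M (h i)" and le: "\<And>i. L2_norm M (h i) \<le> (1/3) ^ i"
    and u: "square_integrable M u"
  shows "(\<lambda>i. LINT x|M. u x \<bullet> h i x) sums (LINT x|M. u x \<bullet> (\<Sum>i. h i x))"
proof -
  note sum = square_integrable_suminf(1)[OF h le]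
  have [measurable]: "u \<in> borel_measurable M" "h i \<in> borel_measurable M" for i
    using u h square_integrable_measurable by blast+
  have "(\<lambda>i. LINT x|M. u x \<bullet> h i x) sums (LINT x|M. (\<Sum>i. u x \<bullet> h i x))"
  proof (rule sums_integral)
    show "integrable M (\<lambda>x. u x \<bullet> h i x)" for i
      by (rule L2_inner_integrable[OF u h])
    show "AE x in M. summable (\<lambda>i. norm (u x \<bullet> h i x))"
      using sum
    proof eventually_elim
      case (elim x)
      then have "summable (\<lambda>i. norm (u x) * norm (h i x))"
        by (rule summable_mult)
      then show ?case
        by (rule summable_comparison_test'[where N=0]) (simp add: Cauchy_Schwarz_ineq2)
    qed
    have "summable (\<lambda>i. L2_norm M u * (1/3) ^ i)"
      by (intro summable_mult summable_geometric) simp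
    moreover have "(LINT x|M. norm (u x \<bullet> h i x)) \<le> L2_norm M u * (1/3) ^ i" for i
      by (rule order_trans[OF L2_inner_integrable(2)[OF u h]])
         (intro mult_left_mono le L2_norm_nonneg)
    ultimately show "summable (\<lambda>i. LINT x|M. norm (u x \<bullet> h i x))"
      by (elim summable_comparison_test'[where N=0]) simp
  qed
  also have "(LINT x|M. (\<Sum>i. u x \<bullet> h i x)) = (LINT x|M. u x \<bullet> (\<Sum>i. h i x))"
  proof (rule integral_cong_AE)
    show "AE x in M. (\<Sum>i. u x \<bullet> h i x) = u x \<bullet> (\<Sum>i. h i x)"
      using sum
    proof eventually_elim
      case (elim x)
      show ?case
        by (rule bounded_linear.suminf[OF bounded_linear_inner_right summable_norm_cancel[OF elim], symmetric])
    qed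
  qed simp_all
  finally show ?thesis .
qed

text \<open>Sokal's elementary argument for the uniform boundedness principle: choosing the sign of each
  increment \<open>3\<^sup>-\<^sup>j v\<^sub>j / \<parallel>v\<^sub>j\<parallel>\<close> suitably makes the pairing of the sum with \<open>v\<^sub>j\<close> at least
  \<open>3\<^sup>-\<^sup>j \<parallel>v\<^sub>j\<parallel> / 2\<close>.\<close>

theorem L2_uniform_boundedness:
  fixes u :: "nat \<Rightarrow> 'a \<Rightarrow> 'b::euclidean_space"
  assumes u: "\<And>m. square_integrable M (u m)"
    and bdd: "\<And>w. square_integrable M w \<Longrightarrow> Bseq (\<lambda>m. LINT x|M. u m x \<bullet> w x)"
  obtains B where "B > 0" "\<And>m. L2_norm M (u m) \<le> B"
proof (rule ccontr)
  assume "\<not> thesis"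
  \<comment> \<open>Norms of at least \<open>4 ^ j\<close> against increments of norm
    \<open>(1/3) ^ j\<close> leave \<open>(4/3) ^ j\<close>, which is unbounded.\<close>
  then have "\<exists>m. L2_norm M (u m) \<ge> 4 ^ j" for j :: nat
    using that[of "4 ^ j"] by (meson less_eq_real_def linorder_not_le zero_less_numeral zero_less_power)
  then obtain m where m: "\<And>j::nat. L2_norm M (u (m j)) \<ge> 4 ^ j"
    by metis
  define v where "v j = u (m j)" for j
  define n where "n j = L2_norm M (v j)" for j
  have n: "n j \<ge> 4 ^ j" "n j > 0" for j
  proof -
    show "n j \<ge> 4 ^ j" using m by (simp add: n_def v_def)
    then show "n j > 0" by (meson less_le_trans zero_less_numeral zero_less_power)
  qed
  have v: "square_integrable M (v j)" for j
    by (simp add: v_def u)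
  define h where "h j x = ((1/3) ^ j / n j) *\<^sub>R v j x" for j x
  have h: "square_integrable M (h j)" for j
    unfolding h_def by (intro square_integrable_scaleR v)
  have nh: "L2_norm M (h j) = (1/3) ^ j" for j
    using n(2)[of j] unfolding h_def L2_norm_scaleR n_def[symmetric] by simp
  have vh: "(LINT x|M. v j x \<bullet> h j x) = (1/3) ^ j * n j" for j
    using n(2)[of j] by (simp add: h_def L2_inner_self n_def[symmetric] power2_eq_square)
  define T where "T j w = (LINT x|M. v j x \<bullet> w x)" for j and w :: "'a \<Rightarrow> 'b"
  have "\<exists>\<sigma> :: nat \<Rightarrow> real. \<forall>j. \<bar>\<sigma> j\<bar> = 1 \<and> (1/3) ^ j * n j \<le> \<bar>\<Sum>i<Suc j. \<sigma> i * T j (h i)\<bar>"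
  proof -
    \<comment> \<open>Each sign depends on all earlier ones. \<open>P xs s\<close> says that
      \<open>s\<close> is good after the list \<open>xs\<close> of earlier signs: it is taken to
      agree in sign with the partial sum, so that the new term cannot cancel against it. Recursion
      on the list then yields the sequence.\<close>
    define P where "P xs (s::real) \<longleftrightarrow> \<bar>s\<bar> = 1 \<and> (1/3) ^ length xs * n (length xs) \<le>
      \<bar>(\<Sum>i<length xs. xs ! i * T (length xs) (h i)) + s * T (length xs) (h (length xs))\<bar>"
      for xs s
    have "\<exists>s. P xs s" for xs
    proof -
      let ?j = "length xs"
      let ?S = "\<Sum>i<?j. xs ! i * T ?j (h i)" and ?t = "(1/3) ^ ?j * n ?j"
      have t: "T ?j (h ?j) = ?t" "?t \<ge> 0"
        using vh n(2)[of ?j] by (simp_all add: T_def)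
      show ?thesis
      proof (cases "?S \<ge> 0")
        case True
        then have "P xs 1" using t by (simp add: P_def)
        then show ?thesis by blast
      next
        case False
        then have "P xs (-1)" using t by (simp add: P_def)
        then show ?thesis by blast
      qed
    qed
    then obtain c where c: "\<And>xs. P xs (c xs)"
      by metis
    define xs where "xs = rec_nat [] (\<lambda>_ ys. ys @ [c ys])"
    have xs: "xs 0 = []" "xs (Suc j) = xs j @ [c (xs j)]" for j
      by (simp_all add: xs_def)
    have len: "length (xs j) = j" for j
      by (induction j) (simp_all add: xs)
    have nth: "i < j \<Longrightarrow> xs j ! i = c (xs i)" for i j
      by (induction j) (auto simp: xs nth_append len less_Suc_eq)
    show ?thesis
    proof (intro exI[of _ "\<lambda>j. c (xs j)"] allI)
      show "\<bar>c (xs j)\<bar> = 1 \<and> (1/3) ^ j * n j \<le> \<bar>\<Sum>i<Suc j. c (xs i) * T j (h i)\<bar>" for j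
        using c[of "xs j"] by (simp add: P_def len nth)
    qed
  qed
  then obtain \<sigma> :: "nat \<Rightarrow> real"
    where \<sigma>: "\<And>j. \<bar>\<sigma> j\<bar> = 1" "\<And>j. (1/3) ^ j * n j \<le> \<bar>\<Sum>i<Suc j. \<sigma> i * T j (h i)\<bar>"
    by blast
  define g where "g i x = \<sigma> i *\<^sub>R h i x" for i x
  have g: "square_integrable M (g i)" "L2_norm M (g i) \<le> (1/3) ^ i" for i
    using h nh \<sigma>(1) unfolding g_def by (auto simp: L2_norm_scaleR intro: square_integrable_scaleR)
  define w where "w x = (\<Sum>i. g i x)" for x
  have lower: "(4/3) ^ j \<le> 2 * \<bar>T j w\<bar>" for j
  proof -
    have sums: "(\<lambda>i. \<sigma> i * T j (h i)) sums T j w"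
      using L2_inner_suminf[OF g v, of j] by (simp add: T_def w_def g_def)
    have tail: "(\<lambda>i. \<sigma> (i + Suc j) * T j (h (i + Suc j))) sums (T j w - (\<Sum>i<Suc j. \<sigma> i * T j (h i)))"
      using sums by (subst sums_iff_shift') simp
    have bound: "norm (\<sigma> i * T j (h i)) \<le> n j * (1/3) ^ i" for i
      using L2_inner_le[OF v h, of j i] by (simp add: abs_mult \<sigma>(1) T_def nh n_def)
    \<comment> \<open>The geometric tail starting at \<open>Suc j\<close> is half of the lower bound
      in \<open>\<sigma>(2)\<close>, so the later increments can destroy at most half of it.\<close>
    have geo: "(\<lambda>i. n j * (1/3) ^ (i + Suc j)) sums ((1/3) ^ j * n j / 2)"
    proof -
      have "(\<lambda>i. (n j * (1/3) ^ Suc j) * (1/3) ^ i) sums ((n j * (1/3) ^ Suc j) * (1 / (1 - 1/3)))"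
        by (intro sums_mult geometric_sums) simp
      then show ?thesis
        by (simp add: power_add mult_ac)
    qed
    have "\<bar>T j w - (\<Sum>i<Suc j. \<sigma> i * T j (h i))\<bar> \<le> (1/3) ^ j * n j / 2"
      unfolding sums_unique[OF tail] sums_unique[OF geo] real_norm_def[symmetric]
      by (rule norm_suminf_le[OF bound sums_summable[OF geo]])
    with \<sigma>(2)[of j] have "(1/3) ^ j * n j \<le> 2 * \<bar>T j w\<bar>"
      by linarith
    moreover have "(4/3) ^ j = (1/3) ^ j * (4::real) ^ j"
      by (simp flip: power_mult_distrib)
    moreover have "(1/3) ^ j * (4::real) ^ j \<le> (1/3) ^ j * n j"
      using n(1) by (intro mult_left_mono) auto
    ultimately show ?thesis by linarith
  qed
  have "square_integrable M w"
    unfolding w_def by (rule square_integrable_suminf(2)[OF g])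
  from bdd[OF this] obtain K where K: "\<And>m. \<bar>LINT x|M. u m x \<bullet> w x\<bar> \<le> K"
    unfolding Bseq_def by auto
  have "\<exists>j. 2 * K < (4/3) ^ j"
    by (rule real_arch_pow) simp
  then obtain j where "2 * K < (4/3) ^ j" ..
  with lower[of j] K[of "m j"] show False
    by (simp add: T_def v_def)
qed

section \<open>Gronwall's inequality with a square-integrable rate\<close>

lemma finite_measure_lebesgue_on_interval: "finite_measure (lebesgue_on {a..b::real})"
  by (rule finite_measure_lebesgue_on) simp

lemma sets_lebesgue_on_Icc: "t \<in> {a..b} \<Longrightarrow> {a..t} \<in> sets (lebesgue_on {a..b::real})"
  by (auto simp: sets_restrict_space_iff)

lemma continuous_on_imp_square_integrable:
  fixes f :: "real \<Rightarrow> 'a::euclidean_space"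
  assumes "continuous_on {a..b} f"
  shows "square_integrable (lebesgue_on {a..b}) f"
  unfolding square_integrable_def
proof
  show m: "f \<in> borel_measurable (lebesgue_on {a..b})"
    using assms by (intro continuous_imp_measurable_on_sets_lebesgue) auto
  have "bounded (f ` {a..b})"
    using assms by (intro compact_imp_bounded compact_continuous_image) auto
  then obtain C where "\<And>x. x \<in> {a..b} \<Longrightarrow> norm (f x) \<le> C"
    unfolding bounded_iff by blast
  then show "integrable (lebesgue_on {a..b}) (\<lambda>x. (norm (f x))\<^sup>2)"
    using m by (intro finite_measure.integrable_const_bound[OF finite_measure_lebesgue_on_interval, where B="C\<^sup>2"])
       (auto simp: power_mono)
qed

lemma square_integrable_imp_integrable_interval:
  fixes u :: "real \<Rightarrow> 'a::euclidean_space"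
  assumes "square_integrable (lebesgue_on {a..b}) u"
  shows "integrable (lebesgue_on {a..b}) u"
proof -
  have "square_integrable (lebesgue_on {a..b}) (\<lambda>_. 1::real)"
    by (rule continuous_on_imp_square_integrable) simp
  from L2_Cauchy_Schwarz(1)[OF assms this] show ?thesis
    using square_integrable_measurable[OF assms] by (simp add: integrable_norm_iff)
qed

text \<open>The squared difference of two cut-offs is the indicator of the interval between the two
  times. This is the source of the modulus of continuity in time.\<close>

lemma L2_norm_indicator_diff:
  fixes s t :: real
  assumes "s \<in> {0..1}" "t \<in> {0..1}"
  shows "square_integrable (lebesgue_on {0..1}) (\<lambda>x. indicat_real {0..s} x - indicator {0..t} x)"
    and "L2_norm (lebesgue_on {0..1}) (\<lambda>x. indicat_real {0..s} x - indicator {0..t} x) = sqrt \<bar>s - t\<bar>"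
proof -
  have *: "integrable (lebesgue_on {0..1}) (indicat_real {min s t<..max s t})
    \<and> (LINT x|lebesgue_on {0..1}. indicat_real {min s t<..max s t} x) = \<bar>s - t\<bar>"
  proof -
    define I where "I = {min s t<..max s t}"
    have I: "I \<subseteq> {0..1}"
      using assms by (auto simp: I_def)
    have "emeasure (lebesgue_on {0..1}) I = emeasure lebesgue I"
      using I by (intro emeasure_restrict_space) auto
    also have "\<dots> = ennreal \<bar>s - t\<bar>"
      by (simp add: I_def min_def max_def)
    finally have e: "emeasure (lebesgue_on {0..1}) I = ennreal \<bar>s - t\<bar>" .
    moreover have "I \<in> sets (lebesgue_on {0..1})"
      using I by (simp add: sets_restrict_space_iff) (simp add: I_def)
    ultimately have "integrable (lebesgue_on {0..1}) (indicat_real I)"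
      by (intro integrable_real_indicator) auto
    moreover have "(LINT x|lebesgue_on {0..1}. indicat_real I x) = \<bar>s - t\<bar>"
      using e I by (simp add: measure_def Int_absorb2)
    ultimately show ?thesis
      by (simp add: I_def)
  qed
  have sq: "(norm (indicat_real {0..s} x - indicator {0..t} x))\<^sup>2 = indicat_real {min s t<..max s t} x"
    for x
    using assms by (auto simp: indicator_def)
  have m: "indicat_real {0..r} \<in> borel_measurable (lebesgue_on {0..1})" if "r \<in> {0..1}" for r :: real
    by (intro borel_measurable_indicator sets_lebesgue_on_Icc that)
  show "square_integrable (lebesgue_on {0..1}) (\<lambda>x. indicat_real {0..s} x - indicator {0..t} x)"
    unfolding square_integrable_def sq using * m assms by auto
  show "L2_norm (lebesgue_on {0..1}) (\<lambda>x. indicat_real {0..s} x - indicator {0..t} x) = sqrt \<bar>s - t\<bar>"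
    unfolding L2_norm_def sq using * by simp
qed

text \<open>The squared integrand is \<open>exp (2 * c * s)\<close> up to \<open>t\<close>, whose
  primitive brings the factor \<open>1 / (2 * c)\<close>: a large \<open>c\<close> makes the norm
  small relative to the weight \<open>exp (c * t)\<close>.\<close>

lemma L2_norm_indicator_exp_le:
  fixes c t :: real
  assumes "c > 0" "t \<in> {0..1}"
  shows "square_integrable (lebesgue_on {0..1}) (\<lambda>s. indicator {0..t} s * exp (c * s))"
    and "L2_norm (lebesgue_on {0..1}) (\<lambda>s. indicator {0..t} s * exp (c * s)) \<le> exp (c * t) / sqrt (2 * c)"
proof -
  have e: "square_integrable (lebesgue_on {0..1}) (\<lambda>s. exp (c * s))"
    by (intro continuous_on_imp_square_integrable continuous_intros)
  show "square_integrable (lebesgue_on {0..1}) (\<lambda>s. indicator {0..t} s * exp (c * s))"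
    using square_integrable_indicator[OF e sets_lebesgue_on_Icc[OF assms(2)]] by simp
  have int: "integrable (lebesgue_on {0..1}) (\<lambda>s. exp (2 * c * s))"
    by (intro square_integrable_imp_integrable_interval continuous_on_imp_square_integrable continuous_intros)
  have "(LINT s|lebesgue_on {0..1}. (norm (indicator {0..t} s * exp (c * s)))\<^sup>2)
      = (LINT s|lebesgue_on {0..1}. indicator {0..t} s *\<^sub>R exp (2 * c * s))"
    by (intro Bochner_Integration.integral_cong)
       (auto simp: indicator_def power2_eq_square simp flip: exp_add)
  also have "\<dots> = (LINT s|lebesgue_on {0..t}. exp (2 * c * s))"
    using assms by (intro LINT_lebesgue_on_indicator(2)[OF int, symmetric]) auto
  also have "\<dots> = exp (2 * c * t) / (2 * c) - exp (2 * c * 0) / (2 * c)"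
  proof (rule has_integral_unique)
    show "((\<lambda>s. exp (2 * c * s)) has_integral (LINT s|lebesgue_on {0..t}. exp (2 * c * s))) {0..t}"
      using assms by (intro has_integral_integral_lebesgue_on LINT_lebesgue_on_indicator(1)[OF int]) auto
    show "((\<lambda>s. exp (2 * c * s)) has_integral (exp (2 * c * t) / (2 * c) - exp (2 * c * 0) / (2 * c))) {0..t}"
    proof (rule fundamental_theorem_of_calculus)
      show "((\<lambda>s. exp (2 * c * s) / (2 * c)) has_vector_derivative exp (2 * c * s)) (at s within {0..t})" for s
        unfolding has_real_derivative_iff_has_vector_derivative[symmetric]
        using assms by (auto intro!: derivative_eq_intros)
    qed (use assms in auto)
  qed
  also have "\<dots> \<le> (exp (c * t) / sqrt (2 * c))\<^sup>2"
  proof -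
    have "(exp (c * t) / sqrt (2 * c))\<^sup>2 = exp (2 * c * t) / (2 * c)"
      using assms by (simp add: power_divide exp_double[symmetric] mult_ac)
    then show ?thesis
      using assms by simp
  qed
  finally show "L2_norm (lebesgue_on {0..1}) (\<lambda>s. indicator {0..t} s * exp (c * s)) \<le> exp (c * t) / sqrt (2 * c)"
    unfolding L2_norm_def using assms by (intro real_le_lsqrt) auto
qed

text \<open>In the sup norm weighted by \<open>exp (- 2 B\<^sup>2 t)\<close> the integral operator has norm at most \<open>1 / 2\<close>, by
  the Cauchy--Schwarz inequality; this avoids differentiating \<open>exp (\<integral> b)\<close>.\<close>

lemma L2_Gronwall:
  fixes e b :: "real \<Rightarrow> real"
  assumes cont: "continuous_on {0..1} e" and "\<And>s. s \<in> {0..1} \<Longrightarrow> 0 \<le> e s"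
    and b: "square_integrable (lebesgue_on {0..1}) b" and b0: "\<And>s. 0 \<le> b s"
    and B: "L2_norm (lebesgue_on {0..1}) b \<le> B" "B > 0" and "a \<ge> 0"
    and ineq: "\<And>t. t \<in> {0..1} \<Longrightarrow> e t \<le> a + (LINT s|lebesgue_on {0..1}. indicator {0..t} s * (b s * e s))"
    and t: "t \<in> {0..1}"
  shows "e t \<le> 2 * a * exp (2 * B\<^sup>2)"
proof -
  \<comment> \<open>Chosen so that \<open>sqrt (2 * c) = 2 * B\<close>, hence
    \<open>B / sqrt (2 * c) = 1 / 2\<close>.\<close>
  define c where "c = 2 * B\<^sup>2"
  have "c > 0" using B by (simp add: c_def)
  let ?M = "lebesgue_on {0..1::real}"
  have "continuous_on {0..1} (\<lambda>s. e s * exp (- c * s))"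
    by (intro continuous_intros cont)
  from continuous_attains_sup[OF compact_Icc _ this] obtain r where
    r: "r \<in> {0..1}" "\<And>s. s \<in> {0..1} \<Longrightarrow> e s * exp (- c * s) \<le> e r * exp (- c * r)"
    by auto
  \<comment> \<open>\<open>K\<close> is the weighted sup norm of \<open>e\<close>, attained by
    continuity. The hypothesis at the maximiser \<open>r\<close> alone gives
    \<open>K \<le> a + K / 2\<close>.\<close>
  define K where "K = e r * exp (- c * r)"
  have "K \<ge> 0" using assms(2) r(1) by (simp add: K_def)
  have le: "e s \<le> K * exp (c * s)" if "s \<in> {0..1}" for s
    using r(2)[OF that] by (simp add: K_def exp_minus field_simps)
  let ?g = "\<lambda>s. indicator {0..r} s * exp (c * s)"
  note g = L2_norm_indicator_exp_le[OF \<open>c > 0\<close> r(1)]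
  have bg: "integrable ?M (\<lambda>s. b s * ?g s)"
    using L2_inner_integrable(1)[OF b g(1)] by simp
  have int: "integrable ?M (\<lambda>s. indicator {0..r} s * (b s * e s))"
  proof -
    have "integrable ?M (\<lambda>s. b s * e s)"
      using L2_inner_integrable(1)[OF b continuous_on_imp_square_integrable[OF cont]] by simp
    then show ?thesis
      using integrable_mult_indicator[OF sets_lebesgue_on_Icc[OF r(1)], of "\<lambda>s. b s * e s"] by simp
  qed
  have "e r \<le> a + (LINT s|?M. indicator {0..r} s * (b s * e s))"
    by (rule ineq[OF r(1)])
  also have "(LINT s|?M. indicator {0..r} s * (b s * e s)) \<le> (LINT s|?M. K * (b s * ?g s))"
  proof (rule integral_mono[OF int])
    show "integrable ?M (\<lambda>s. K * (b s * ?g s))"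
      using bg by simp
    show "indicator {0..r} s * (b s * e s) \<le> K * (b s * ?g s)" if "s \<in> space ?M" for s
      using mult_left_mono[OF le b0, of s s] that by (simp add: indicator_def mult_ac)
  qed
  also have "\<dots> = K * (LINT s|?M. b s * ?g s)"
    by simp
  also have "\<dots> \<le> K * (B * (exp (c * r) / sqrt (2 * c)))"
  proof (rule mult_left_mono[OF _ \<open>K \<ge> 0\<close>])
    have "(LINT s|?M. b s * ?g s) \<le> L2_norm ?M b * L2_norm ?M ?g"
      using L2_inner_le[OF b g(1)] by simp
    also have "\<dots> \<le> B * (exp (c * r) / sqrt (2 * c))"
      using B g(2) by (intro mult_mono L2_norm_nonneg) auto
    finally show "(LINT s|?M. b s * ?g s) \<le> B * (exp (c * r) / sqrt (2 * c))" .
  qed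
  also have "sqrt (2 * c) = 2 * B"
    using B(2) by (simp add: c_def real_sqrt_mult)
  finally have "e r \<le> a + K * exp (c * r) / 2"
    using B(2) by simp
  then have "e r * exp (- c * r) \<le> (a + K * exp (c * r) / 2) * exp (- c * r)"
    by (rule mult_right_mono) simp
  also have "\<dots> = a * exp (- c * r) + K / 2"
    by (simp add: algebra_simps flip: exp_add)
  also have "a * exp (- c * r) \<le> a * 1"
    using \<open>a \<ge> 0\<close> \<open>c > 0\<close> r(1) by (intro mult_left_mono) auto
  finally have "K \<le> 2 * a"
    by (simp add: K_def)
  have "e t \<le> K * exp (c * t)"
    by (rule le[OF t])
  also have "\<dots> \<le> 2 * a * exp c"
    using \<open>K \<le> 2 * a\<close> \<open>K \<ge> 0\<close> \<open>c > 0\<close> t by (intro mult_mono) auto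
  finally show ?thesis
    by (simp add: c_def)
qed

text \<open>Pointwise convergence is uniform on finite sets, and equicontinuity carries it from the
  centres of a finite subcover to all of \<open>K\<close>. It is essential that the radii do not
  depend on \<open>m\<close>.\<close>

lemma equicontinuous_tendsto_zero_imp_uniform:
  fixes f :: "nat \<Rightarrow> 'a::metric_space \<Rightarrow> 'b::real_normed_vector"
  assumes "compact K" and lim: "\<And>x. x \<in> K \<Longrightarrow> (\<lambda>m. f m x) \<longlonglongrightarrow> 0"
    and equi: "\<And>x e. x \<in> K \<Longrightarrow> e > 0 \<Longrightarrow>
        \<exists>d>0. \<forall>m. \<forall>y\<in>K. dist y x < d \<longrightarrow> norm (f m y - f m x) < e"
    and "e > 0"
  shows "\<forall>\<^sub>F m in sequentially. \<forall>x\<in>K. norm (f m x) < e"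
proof -
  have "\<forall>x\<in>K. \<exists>d>0. \<forall>m. \<forall>y\<in>K. dist y x < d \<longrightarrow> norm (f m y - f m x) < e / 2"
    using equi[of _ "e / 2"] \<open>e > 0\<close> by simp
  then obtain d where d: "\<And>x. x \<in> K \<Longrightarrow> d x > 0"
    "\<And>x m y. x \<in> K \<Longrightarrow> y \<in> K \<Longrightarrow> dist y x < d x \<Longrightarrow> norm (f m y - f m x) < e / 2"
    by metis
  obtain C where C: "C \<subseteq> K" "finite C" "K \<subseteq> (\<Union>x\<in>C. ball x (d x))"
  proof (rule compactE_image[OF \<open>compact K\<close>])
    show "K \<subseteq> (\<Union>x\<in>K. ball x (d x))"
      using d(1) by fastforce
  qed auto
  have "\<forall>\<^sub>F m in sequentially. norm (f m x) < e / 2" if "x \<in> K" for x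
    using tendstoD[OF lim[OF that], of "e / 2"] \<open>e > 0\<close> by simp
  then have "\<forall>\<^sub>F m in sequentially. \<forall>x\<in>C. norm (f m x) < e / 2"
    using C by (intro eventually_ball_finite) auto
  then show ?thesis
  proof eventually_elim
    case (elim m)
    show ?case
    proof
      fix y assume "y \<in> K"
      then obtain x where x: "x \<in> C" "dist y x < d x"
        using C(3) by (auto simp: dist_commute)
      have "norm (f m y) \<le> norm (f m y - f m x) + norm (f m x)"
        using norm_triangle_sub[of "f m y" "f m x"] by (simp add: add.commute)
      also have "\<dots> < e / 2 + e / 2"
        using d(2)[of x y m] x C(1) \<open>y \<in> K\<close> elim by (intro add_strict_mono) auto
      finally show "norm (f m y) < e" by simp
    qed
  qed
qed

section \<open>Stability of trajectories\<close>

lemma L2_norm_one_interval: "L2_norm (lebesgue_on {0..1::real}) (\<lambda>_. 1::real) = 1"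
  by (simp add: L2_norm_def measure_restrict_space)

lemma LINT_norm_le_L2_norm:
  fixes u :: "real \<Rightarrow> 'a::euclidean_space"
  assumes "square_integrable (lebesgue_on {0..1}) u"
  shows "(LINT s|lebesgue_on {0..1}. norm (u s)) \<le> L2_norm (lebesgue_on {0..1}) u"
  using L2_Cauchy_Schwarz(2)[OF assms continuous_on_imp_square_integrable[where f="\<lambda>_. 1::real"]]
  by (simp add: L2_norm_one_interval)

lemma norm_LINT_le:
  fixes f :: "'a \<Rightarrow> 'b::euclidean_space"
  assumes "f \<in> borel_measurable M" "integrable M g" "\<And>x. x \<in> space M \<Longrightarrow> norm (f x) \<le> g x"
  shows "norm (LINT x|M. f x) \<le> (LINT x|M. g x)"
proof -
  have f: "integrable M f"
    by (rule Bochner_Integration.integrable_bound[OF assms(2,1)])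
       (use assms(3) in \<open>auto intro!: AE_I2 intro: order_trans[OF _ abs_ge_self]\<close>)
  have "norm (LINT x|M. f x) \<le> (LINT x|M. norm (f x))"
    by (rule integral_norm_bound)
  also have "\<dots> \<le> (LINT x|M. g x)"
    using f assms by (intro integral_mono) auto
  finally show ?thesis .
qed

locale lipschitz_control_system =
  fixes \<Theta> :: "('p::euclidean_space) set"
    and F0 :: "real ^ 'n \<Rightarrow> 'p \<Rightarrow> real ^ 'n"
    and F :: "real ^ 'n \<Rightarrow> 'p \<Rightarrow> real ^ 'k ^ 'n"
    and L :: real
  assumes L_pos: "L > 0"
    and F0_lipschitz: "\<And>x1 x2 \<theta>1 \<theta>2. \<theta>1 \<in> \<Theta> \<Longrightarrow> \<theta>2 \<in> \<Theta> \<Longrightarrow>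
           norm (F0 x1 \<theta>1 - F0 x2 \<theta>2) \<le> L * (norm (x1 - x2) + norm (\<theta>1 - \<theta>2))"
    and F_lipschitz: "\<And>i x1 x2 \<theta>1 \<theta>2. \<theta>1 \<in> \<Theta> \<Longrightarrow> \<theta>2 \<in> \<Theta> \<Longrightarrow>
           norm (column i (F x1 \<theta>1) - column i (F x2 \<theta>2)) \<le> L * (norm (x1 - x2) + norm (\<theta>1 - \<theta>2))"
begin

abbreviation unit_interval_measure :: "real measure" ("\<mu>") where
  "\<mu> \<equiv> lebesgue_on {0..1}"

section \<open>Estimates for the vector fields along a continuous curve\<close>

lemma matrix_vector_mult_columns:
  "A *v w = (\<Sum>i\<in>UNIV. (w $ i) *\<^sub>R column i A)" for A :: "real ^ 'k ^ 'n"
  by (simp add: matrix_mult_sum scalar_mult_eq_scaleR)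

text \<open>The product combines \<open>CARD('k)\<close> columns with coefficients of absolute value
  at most \<open>norm w\<close>; the factor \<open>real CARD('k)\<close> in the later constants
  comes from here.\<close>

lemma F_mult_lipschitz:
  assumes "\<theta>1 \<in> \<Theta>" "\<theta>2 \<in> \<Theta>"
  shows "norm (F x1 \<theta>1 *v w - F x2 \<theta>2 *v w)
    \<le> L * (real CARD('k) * norm w) * (norm (x1 - x2) + norm (\<theta>1 - \<theta>2))"
proof -
  have "norm (F x1 \<theta>1 *v w - F x2 \<theta>2 *v w)
      = norm (\<Sum>i\<in>UNIV. (w $ i) *\<^sub>R (column i (F x1 \<theta>1) - column i (F x2 \<theta>2)))"
    by (simp add: matrix_vector_mult_columns sum_subtractf scaleR_diff_right)
  also have "\<dots> \<le> (\<Sum>i\<in>(UNIV::'k set). norm w * (L * (norm (x1 - x2) + norm (\<theta>1 - \<theta>2))))"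
  proof (rule sum_norm_le)
    fix i :: 'k
    show "norm ((w $ i) *\<^sub>R (column i (F x1 \<theta>1) - column i (F x2 \<theta>2)))
        \<le> norm w * (L * (norm (x1 - x2) + norm (\<theta>1 - \<theta>2)))"
      unfolding norm_scaleR
      using F_lipschitz[OF assms] component_le_norm_cart[of w i] by (intro mult_mono) auto
  qed
  finally show ?thesis by (simp add: mult_ac)
qed

lemma continuous_on_column:
  assumes "continuous_on S x" "\<theta> \<in> \<Theta>"
  shows "continuous_on S (\<lambda>s. column i (F (x s) \<theta>))"
proof -
  have "continuous_on UNIV (\<lambda>y. column i (F y \<theta>))"
  proof (rule lipschitz_on_continuous_on[of L])
    show "L-lipschitz_on UNIV (\<lambda>y. column i (F y \<theta>))"
      using F_lipschitz[OF assms(2,2)] L_pos by (intro lipschitz_onI) (auto simp: dist_norm)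
  qed
  from continuous_on_compose2[OF this assms(1)] show ?thesis by simp
qed

lemma continuous_on_drift:
  assumes "continuous_on S x" "\<theta> \<in> \<Theta>"
  shows "continuous_on S (\<lambda>s. F0 (x s) \<theta>)"
proof -
  have "continuous_on UNIV (\<lambda>y. F0 y \<theta>)"
  proof (rule lipschitz_on_continuous_on[of L])
    show "L-lipschitz_on UNIV (\<lambda>y. F0 y \<theta>)"
      using F0_lipschitz[OF assms(2,2)] L_pos by (intro lipschitz_onI) (auto simp: dist_norm)
  qed
  from continuous_on_compose2[OF this assms(1)] show ?thesis by simp
qed

lemma F_mult_measurable:
  assumes "continuous_on {0..1} x" "\<theta> \<in> \<Theta>" "u \<in> borel_measurable \<mu>"
  shows "(\<lambda>s. F (x s) \<theta> *v u s) \<in> borel_measurable \<mu>"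
  unfolding matrix_vector_mult_columns
proof (intro borel_measurable_sum borel_measurable_scaleR)
  show "(\<lambda>s. u s $ i) \<in> borel_measurable \<mu>" for i
    using borel_measurable_inner[OF assms(3) borel_measurable_const[of "axis i 1"]]
    by (simp add: inner_axis)
  show "(\<lambda>s. column i (F (x s) \<theta>)) \<in> borel_measurable \<mu>" for i
    by (intro square_integrable_measurable continuous_on_imp_square_integrable continuous_on_column assms)
qed

lemma F_mult_bounded:
  fixes x :: "real \<Rightarrow> real ^ 'n"
  assumes "continuous_on {0..1} x" "\<theta> \<in> \<Theta>"
  obtains C where "C > 0" "\<And>s w. s \<in> {0..1} \<Longrightarrow> norm (F (x s) \<theta> *v w) \<le> C * norm w"
proof -
  have "\<exists>C. \<forall>s\<in>{0..1}. norm (column i (F (x s) \<theta>)) \<le> C" for i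
  proof -
    have "bounded ((\<lambda>s. column i (F (x s) \<theta>)) ` {0..1})"
      by (intro compact_imp_bounded compact_continuous_image continuous_on_column assms compact_Icc)
    then show ?thesis
      unfolding bounded_iff by simp
  qed
  then obtain c where c: "\<And>i s. s \<in> {0..1} \<Longrightarrow> norm (column i (F (x s) \<theta>)) \<le> c i"
    by metis
  \<comment> \<open>The summand \<open>1\<close> makes the bound positive, as it will appear in a
    denominator.\<close>
  have "norm (F (x s) \<theta> *v w) \<le> (1 + (\<Sum>i\<in>UNIV. \<bar>c i\<bar>)) * norm w" if "s \<in> {0..1}" for s w
  proof -
    have "norm (F (x s) \<theta> *v w) \<le> (\<Sum>i\<in>UNIV. norm w * \<bar>c i\<bar>)"
      unfolding matrix_vector_mult_columns
    proof (rule sum_norm_le)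
      show "norm ((w $ i) *\<^sub>R column i (F (x s) \<theta>)) \<le> norm w * \<bar>c i\<bar>" for i
        unfolding norm_scaleR using c[OF that, of i] component_le_norm_cart[of w i]
        by (intro mult_mono) auto
    qed
    also have "\<dots> = (\<Sum>i\<in>UNIV. \<bar>c i\<bar>) * norm w"
      by (simp add: sum_distrib_left[symmetric] mult.commute)
    also have "\<dots> \<le> (1 + (\<Sum>i\<in>UNIV. \<bar>c i\<bar>)) * norm w"
      by (intro mult_right_mono) auto
    finally show ?thesis .
  qed
  moreover have "1 + (\<Sum>i\<in>UNIV. \<bar>c i\<bar>) > 0"
    by (simp add: add_pos_nonneg sum_nonneg)
  ultimately show ?thesis
    using that by blast
qed

lemma F_mult_square_integrable:
  assumes "continuous_on {0..1} x" "\<theta> \<in> \<Theta>" "square_integrable \<mu> u"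
  shows "square_integrable \<mu> (\<lambda>s. F (x s) \<theta> *v u s)"
proof -
  obtain C where C: "C > 0" "\<And>s w. s \<in> {0..1} \<Longrightarrow> norm (F (x s) \<theta> *v w) \<le> C * norm w"
    using F_mult_bounded[OF assms(1,2)] by metis
  show ?thesis
  proof (rule square_integrable_bound[OF assms(3), where C=C])
    show "(\<lambda>s. F (x s) \<theta> *v u s) \<in> borel_measurable \<mu>"
      by (rule F_mult_measurable[OF assms(1,2) square_integrable_measurable[OF assms(3)]])
    show "AE s in \<mu>. norm (F (x s) \<theta> *v u s) \<le> C * norm (u s)"
      using C(2) by (intro AE_I2) simp
  qed
qed

text \<open>The controlled part of the integral equation, linear in \<open>u\<close> and taken along
  any curve \<open>y\<close>, which may differ from the trajectory of \<open>u\<close>. The last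
  integral of the overview is the response to the difference of the controls along the limit
  trajectory.\<close>

definition response :: "(real \<Rightarrow> real ^ 'k) \<Rightarrow> (real \<Rightarrow> real ^ 'n) \<Rightarrow> 'p \<Rightarrow> real \<Rightarrow> real ^ 'n" where
  "response u y \<theta> t = (LINT s|\<mu>. indicator {0..t} s *\<^sub>R (F (y s) \<theta> *v u s))"

text \<open>A Lipschitz constant, in state and parameter, of the right-hand side of the equation at
  time \<open>s\<close>: \<open>L\<close> from the drift, the rest from the controlled part.\<close>

definition gronwall_rate :: "(real \<Rightarrow> real ^ 'k) \<Rightarrow> real \<Rightarrow> real" where
  "gronwall_rate u s = L * (1 + real CARD('k) * norm (u s))"

text \<open>The norm bound is a case of Minkowski's inequality, obtained by expanding the square: on
  an interval of length one, the L1 norm in the cross term is at most the L2 norm.\<close>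

lemma gronwall_rate:
  assumes u: "square_integrable \<mu> u" and le: "L2_norm \<mu> u \<le> B"
  shows "square_integrable \<mu> (gronwall_rate u)" "0 \<le> gronwall_rate u s"
    "L2_norm \<mu> (gronwall_rate u) \<le> L * (1 + real CARD('k) * B)"
proof -
  have one: "square_integrable \<mu> (\<lambda>_. 1::real)"
    by (intro continuous_on_imp_square_integrable continuous_intros)
  have "square_integrable \<mu> (\<lambda>s. L *\<^sub>R (1 + real CARD('k) *\<^sub>R norm (u s)))"
    by (intro square_integrable_scaleR square_integrable_add square_integrable_norm one u)
  then show sq: "square_integrable \<mu> (gronwall_rate u)"
    by (simp add: gronwall_rate_def[abs_def])
  show nonneg: "0 \<le> gronwall_rate u s" for s
    using L_pos by (simp add: gronwall_rate_def)
  have B: "B \<ge> 0" using le L2_norm_nonneg order_trans by blast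
  let ?k = "real CARD('k)"
  have int: "integrable \<mu> (\<lambda>s. norm (u s))" "integrable \<mu> (\<lambda>s. (norm (u s))\<^sup>2)"
    using square_integrable_imp_integrable_interval[OF u] square_integrable_integrable_power2[OF u] by auto
  have "(LINT s|\<mu>. (norm (gronwall_rate u s))\<^sup>2)
      = (LINT s|\<mu>. L\<^sup>2 * (1 + (2 * ?k * norm (u s) + ?k\<^sup>2 * (norm (u s))\<^sup>2)))"
    by (simp add: gronwall_rate_def power2_eq_square algebra_simps)
  also have "\<dots> = L\<^sup>2 * (1 + (2 * ?k * (LINT s|\<mu>. norm (u s)) + ?k\<^sup>2 * (L2_norm \<mu> u)\<^sup>2))"
    using int square_integrable_imp_integrable_interval[OF one]
    by (simp add: L2_norm_power2 measure_restrict_space)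
  also have "\<dots> \<le> L\<^sup>2 * (1 + (2 * ?k * B + ?k\<^sup>2 * B\<^sup>2))"
    using LINT_norm_le_L2_norm[OF u] le L2_norm_nonneg[of \<mu> u]
    by (intro mult_left_mono add_mono power_mono order_refl) auto
  also have "\<dots> = (L * (1 + ?k * B))\<^sup>2"
    by (simp add: power2_eq_square algebra_simps)
  finally show "L2_norm \<mu> (gronwall_rate u) \<le> L * (1 + ?k * B)"
    unfolding L2_norm_def using L_pos B by (intro real_le_lsqrt) auto
qed

lemma trajectory_continuous:
  "is_trajectory F0 F x0 u \<theta> x \<Longrightarrow> continuous_on {0..1} x"
  unfolding is_trajectory_def using abs_continuous_on_imp_continuous_on by blast

lemma trajectory_integral_equation:
  assumes "is_trajectory F0 F x0 u \<theta> x" "\<theta> \<in> \<Theta>" "square_integrable \<mu> u" "t \<in> {0..1}"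
  shows "x t = x0 \<theta> + (LINT s|\<mu>. indicator {0..t} s *\<^sub>R F0 (x s) \<theta>) + response u x \<theta> t"
proof -
  note cont = trajectory_continuous[OF assms(1)]
  have int: "integrable \<mu> (\<lambda>s. F0 (x s) \<theta>)" "integrable \<mu> (\<lambda>s. F (x s) \<theta> *v u s)"
    by (intro square_integrable_imp_integrable_interval continuous_on_imp_square_integrable
        continuous_on_drift F_mult_square_integrable cont assms)+
  have "x t - x 0 = (LINT s|\<mu>. indicator {0..t} s *\<^sub>R (F0 (x s) \<theta> + F (x s) \<theta> *v u s))"
    using assms(1) unfolding is_trajectory_def
    by (intro abs_continuous_on_LINT_derivative assms Bochner_Integration.integrable_add int) auto
  also have "\<dots> = (LINT s|\<mu>. indicator {0..t} s *\<^sub>R F0 (x s) \<theta>) + response u x \<theta> t"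
    unfolding scaleR_add_right response_def
    by (intro Bochner_Integration.integral_add integrable_mult_indicator sets_lebesgue_on_Icc int assms)
  finally show ?thesis
    using assms(1) by (simp add: is_trajectory_def algebra_simps)
qed

lemma response_diff:
  assumes "continuous_on {0..1} x" "continuous_on {0..1} y" "\<theta>1 \<in> \<Theta>" "\<theta>2 \<in> \<Theta>"
    "square_integrable \<mu> u" "square_integrable \<mu> v" "t \<in> {0..1}"
  shows "response u x \<theta>1 t - response v y \<theta>2 t =
    (LINT s|\<mu>. indicator {0..t} s *\<^sub>R (F (x s) \<theta>1 *v u s - F (y s) \<theta>2 *v v s))"
  unfolding response_def scaleR_diff_right
  by (intro Bochner_Integration.integral_diff[symmetric] integrable_mult_indicator sets_lebesgue_on_Icc
      square_integrable_imp_integrable_interval F_mult_square_integrable assms)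

text \<open>It serves twice: with equal parameters it compares different controls, and with equal
  controls, where \<open>\<rho>\<close> may be \<open>0\<close>, it gives continuous dependence on
  the parameter. The difference of the controls enters only through its response along
  \<open>y\<close>, so that weak smallness suffices.\<close>

lemma trajectory_stability:
  assumes x: "is_trajectory F0 F x0 u \<theta>1 x" and y: "is_trajectory F0 F x0 v \<theta>2 y"
    and \<theta>: "\<theta>1 \<in> \<Theta>" "\<theta>2 \<in> \<Theta>"
    and u: "square_integrable \<mu> u" and v: "square_integrable \<mu> v"
    and B: "L2_norm \<mu> u \<le> B"
    and \<rho>: "\<And>t. t \<in> {0..1} \<Longrightarrow> norm (response (\<lambda>s. u s - v s) y \<theta>2 t) \<le> \<rho>"
    and t: "t \<in> {0..1}"
  defines "\<beta> \<equiv> L * (1 + real CARD('k) * B)"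
  shows "norm (x t - y t) \<le> 2 * (norm (x0 \<theta>1 - x0 \<theta>2) + \<beta> * norm (\<theta>1 - \<theta>2) + \<rho>) * exp (2 * \<beta>\<^sup>2)"
proof (rule L2_Gronwall[where e="\<lambda>t. norm (x t - y t)" and b="gronwall_rate u"])
  note cx = trajectory_continuous[OF x] and cy = trajectory_continuous[OF y]
  note b = gronwall_rate[OF u B, folded \<beta>_def]
  show "continuous_on {0..1} (\<lambda>t. norm (x t - y t))"
    by (intro continuous_intros cx cy)
  show "square_integrable \<mu> (gronwall_rate u)" "L2_norm \<mu> (gronwall_rate u) \<le> \<beta>" "0 \<le> gronwall_rate u s" for s
    by (rule b)+
  have "B \<ge> 0" using B L2_norm_nonneg order_trans by blast
  then show "\<beta> > 0" unfolding \<beta>_def using L_pos by (intro mult_pos_pos add_pos_nonneg) auto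
  moreover have "\<rho> \<ge> 0"
    using \<rho>[OF t] norm_ge_zero order_trans by blast
  ultimately show "0 \<le> norm (x0 \<theta>1 - x0 \<theta>2) + \<beta> * norm (\<theta>1 - \<theta>2) + \<rho>"
    by simp
  have bint: "integrable \<mu> (gronwall_rate u)"
    by (rule square_integrable_imp_integrable_interval[OF b(1)])
  have "(LINT s|\<mu>. gronwall_rate u s) \<le> \<beta>"
    using LINT_norm_le_L2_norm[OF b(1)] b(2,3) by (simp add: abs_of_nonneg)
  show "norm (x t - y t) \<le> norm (x0 \<theta>1 - x0 \<theta>2) + \<beta> * norm (\<theta>1 - \<theta>2) + \<rho>
      + (LINT s|\<mu>. indicator {0..t} s * (gronwall_rate u s * norm (x s - y s)))"
    if t: "t \<in> {0..1}" for t
  proof -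
    let ?d = "norm (\<theta>1 - \<theta>2)"
    let ?g = "\<lambda>s. F0 (x s) \<theta>1 - F0 (y s) \<theta>2"
    let ?f = "\<lambda>s. F (x s) \<theta>1 *v u s - F (y s) \<theta>2 *v u s"
    let ?I = "\<lambda>s. indicat_real {0..t} s"
    have int0: "integrable \<mu> ?g"
      by (intro square_integrable_imp_integrable_interval continuous_on_imp_square_integrable
          continuous_on_diff continuous_on_drift cx cy \<theta>)
    have int1: "integrable \<mu> ?f"
      by (intro square_integrable_imp_integrable_interval square_integrable_diff
          F_mult_square_integrable[OF cx \<theta>(1) u] F_mult_square_integrable[OF cy \<theta>(2) u])
    have ind: "integrable \<mu> (\<lambda>s. ?I s *\<^sub>R f s)" if "integrable \<mu> f" for f :: "real \<Rightarrow> real ^ 'n"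
      using that by (intro integrable_mult_indicator sets_lebesgue_on_Icc t)
    have bxy: "integrable \<mu> (\<lambda>s. gronwall_rate u s * norm (x s - y s))"
    proof -
      have "continuous_on {0..1} (\<lambda>s. norm (x s - y s))"
        by (intro continuous_intros cx cy)
      from L2_inner_integrable(1)[OF b(1) continuous_on_imp_square_integrable[OF this]]
      show ?thesis by simp
    qed
    have bxyI: "integrable \<mu> (\<lambda>s. ?I s * (gronwall_rate u s * norm (x s - y s)))"
      using integrable_mult_indicator[OF sets_lebesgue_on_Icc[OF t] bxy] by simp
    have drift: "(LINT s|\<mu>. ?I s *\<^sub>R F0 (x s) \<theta>1) - (LINT s|\<mu>. ?I s *\<^sub>R F0 (y s) \<theta>2)
      = (LINT s|\<mu>. ?I s *\<^sub>R ?g s)"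
      unfolding scaleR_diff_right
      by (intro Bochner_Integration.integral_diff[symmetric] ind square_integrable_imp_integrable_interval
          continuous_on_imp_square_integrable continuous_on_drift cx cy \<theta>)
    \<comment> \<open>\<open>response u y \<theta>2 t\<close> is added and subtracted: the first
      difference changes curve and parameter under the control \<open>u\<close>, the second changes
      the control along \<open>y\<close>.\<close>
    have "x t - y t = x0 \<theta>1 - x0 \<theta>2 + (LINT s|\<mu>. ?I s *\<^sub>R ?g s)
      + (response u x \<theta>1 t - response u y \<theta>2 t) + (response u y \<theta>2 t - response v y \<theta>2 t)"
      unfolding drift[symmetric] trajectory_integral_equation[OF x \<theta>(1) u t]
        trajectory_integral_equation[OF y \<theta>(2) v t] by simp
    also have "response u y \<theta>2 t - response v y \<theta>2 t = response (\<lambda>s. u s - v s) y \<theta>2 t"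
      unfolding response_diff[OF cy cy \<theta>(2) \<theta>(2) u v t]
      by (simp add: response_def matrix_vector_mult_diff_distrib)
    also have "response u x \<theta>1 t - response u y \<theta>2 t = (LINT s|\<mu>. ?I s *\<^sub>R ?f s)"
      by (rule response_diff[OF cx cy \<theta> u u t])
    finally have "x t - y t = x0 \<theta>1 - x0 \<theta>2 + (LINT s|\<mu>. ?I s *\<^sub>R (?g s + ?f s))
        + response (\<lambda>s. u s - v s) y \<theta>2 t"
      unfolding scaleR_add_right
      by (subst Bochner_Integration.integral_add[OF ind[OF int0] ind[OF int1]]) (simp add: add.assoc)
    then have "norm (x t - y t) \<le> norm (x0 \<theta>1 - x0 \<theta>2)
        + norm (LINT s|\<mu>. ?I s *\<^sub>R (?g s + ?f s)) + norm (response (\<lambda>s. u s - v s) y \<theta>2 t)"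
      by (simp only:) (intro norm_triangle_le add_right_mono norm_triangle_ineq)
    \<comment> \<open>Only the state difference keeps its cut-off. The parameter term is integrated
      over the whole interval, which makes it independent of \<open>t\<close>, as the constant
      \<open>a\<close> in Gronwall's inequality must be.\<close>
    also have "norm (LINT s|\<mu>. ?I s *\<^sub>R (?g s + ?f s))
        \<le> (LINT s|\<mu>. ?d * gronwall_rate u s + ?I s * (gronwall_rate u s * norm (x s - y s)))"
    proof (rule norm_LINT_le)
      show "(\<lambda>s. ?I s *\<^sub>R (?g s + ?f s)) \<in> borel_measurable \<mu>"
        by (intro borel_measurable_integrable ind Bochner_Integration.integrable_add int0 int1)
      show "integrable \<mu> (\<lambda>s. ?d * gronwall_rate u s + ?I s * (gronwall_rate u s * norm (x s - y s)))"
        using bint bxyI by simp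
      fix s
      have "norm (?g s + ?f s) \<le> L * (norm (x s - y s) + ?d)
          + L * (real CARD('k) * norm (u s)) * (norm (x s - y s) + ?d)"
        by (intro norm_triangle_le add_mono F0_lipschitz F_mult_lipschitz \<theta>)
      also have "\<dots> = ?d * gronwall_rate u s + gronwall_rate u s * norm (x s - y s)"
        by (simp add: gronwall_rate_def algebra_simps)
      finally show "norm (?I s *\<^sub>R (?g s + ?f s))
          \<le> ?d * gronwall_rate u s + ?I s * (gronwall_rate u s * norm (x s - y s))"
        using b(2)[of s] by (simp add: indicator_def)
    qed
    also have "\<dots> = ?d * (LINT s|\<mu>. gronwall_rate u s)
        + (LINT s|\<mu>. ?I s * (gronwall_rate u s * norm (x s - y s)))"
      using bint bxyI by simp
    also have "norm (response (\<lambda>s. u s - v s) y \<theta>2 t) \<le> \<rho>"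
      by (rule \<rho>[OF t])
    also have "?d * (LINT s|\<mu>. gronwall_rate u s) \<le> \<beta> * ?d"
      using \<open>(LINT s|\<mu>. gronwall_rate u s) \<le> \<beta>\<close> by (subst mult.commute) (simp add: mult_right_mono)
    finally show ?thesis
      by simp
  qed
qed (use t in auto)

section \<open>Response to a weakly convergent sequence of controls\<close>

text \<open>Paired with a vector \<open>b\<close>, the response becomes an L2 inner product:
  transposition moves \<open>F\<close> from the control to \<open>b\<close>, and the cut-off joins
  the test function, which is the same for all \<open>m\<close>.\<close>

lemma response_tendsto_zero:
  fixes v :: "nat \<Rightarrow> real \<Rightarrow> real ^ 'k"
  assumes y: "continuous_on {0..1} y" and \<theta>: "\<theta> \<in> \<Theta>" and v: "\<And>m. square_integrable \<mu> (v m)"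
    and weak: "\<And>w. square_integrable \<mu> w \<Longrightarrow> (\<lambda>m. LINT s|\<mu>. v m s \<bullet> w s) \<longlonglongrightarrow> 0"
    and t: "t \<in> {0..1}"
  shows "(\<lambda>m. response (v m) y \<theta> t) \<longlonglongrightarrow> 0"
proof -
  have "(\<lambda>m. response (v m) y \<theta> t \<bullet> b) \<longlonglongrightarrow> 0" for b
  proof -
    define w where "w s = indicat_real {0..t} s *\<^sub>R (b v* F (y s) \<theta>)" for s
    have "continuous_on {0..1} (\<lambda>s. b v* F (y s) \<theta>)"
    proof -
      have "b v* F (y s) \<theta> = (\<chi> j. column j (F (y s) \<theta>) \<bullet> b)" for s
        by (simp add: vector_matrix_mult_def column_def inner_vec_def vec_eq_iff mult.commute)
      then show ?thesis
        by (simp only:) (intro continuous_intros continuous_on_column y \<theta>)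
    qed
    then have "square_integrable \<mu> w"
      unfolding w_def
      by (intro square_integrable_indicator continuous_on_imp_square_integrable sets_lebesgue_on_Icc t)
    moreover have "response (v m) y \<theta> t \<bullet> b = (LINT s|\<mu>. v m s \<bullet> w s)" for m
    proof -
      have "integrable \<mu> (\<lambda>s. indicator {0..t} s *\<^sub>R (F (y s) \<theta> *v v m s))"
        by (intro integrable_mult_indicator sets_lebesgue_on_Icc t
            square_integrable_imp_integrable_interval F_mult_square_integrable y \<theta> v)
      then have "response (v m) y \<theta> t \<bullet> b = (LINT s|\<mu>. (indicator {0..t} s *\<^sub>R (F (y s) \<theta> *v v m s)) \<bullet> b)"
        unfolding response_def by (intro integral_inner_left[symmetric]) simp
      also have "\<dots> = (LINT s|\<mu>. v m s \<bullet> w s)"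
        by (simp add: w_def dot_lmul_matrix inner_commute[of _ b] inner_commute[of _ "b v* _"])
      finally show ?thesis .
    qed
    ultimately show ?thesis
      using weak by simp
  qed
  then show ?thesis
    by (intro tendsto_componentwise_iff[THEN iffD2]) simp
qed

text \<open>The control enters only through its L1 norm, which \<open>B\<close> dominates, so one
  modulus serves all controls with the same L2 bound.\<close>

lemma response_parameter_diff:
  assumes y: "continuous_on {0..1} y" "continuous_on {0..1} y'" and \<theta>: "\<theta> \<in> \<Theta>" "\<theta>' \<in> \<Theta>"
    and v: "square_integrable \<mu> v" "L2_norm \<mu> v \<le> B"
    and \<eta>: "\<And>s. s \<in> {0..1} \<Longrightarrow> norm (y' s - y s) + norm (\<theta>' - \<theta>) \<le> \<eta>"
    and t: "t \<in> {0..1}"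
  shows "norm (response v y' \<theta>' t - response v y \<theta> t) \<le> L * real CARD('k) * B * \<eta>"
proof -
  have "\<eta> \<ge> 0"
    using \<eta>[OF t] norm_ge_zero[of "y' t - y t"] norm_ge_zero[of "\<theta>' - \<theta>"] by linarith
  let ?f = "\<lambda>s. F (y' s) \<theta>' *v v s - F (y s) \<theta> *v v s"
  have int: "integrable \<mu> (\<lambda>s. norm (v s))"
    using square_integrable_imp_integrable_interval[OF v(1)] by simp
  have "norm (response v y' \<theta>' t - response v y \<theta> t) = norm (LINT s|\<mu>. indicator {0..t} s *\<^sub>R ?f s)"
    by (simp only: response_diff[OF y(2,1) \<theta>(2,1) v(1) v(1) t])
  also have "\<dots> \<le> (LINT s|\<mu>. L * real CARD('k) * \<eta> * norm (v s))"
  proof (rule norm_LINT_le)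
    show "(\<lambda>s. indicator {0..t} s *\<^sub>R ?f s) \<in> borel_measurable \<mu>"
      by (intro square_integrable_measurable square_integrable_indicator sets_lebesgue_on_Icc t
          square_integrable_diff F_mult_square_integrable y \<theta> v)
    show "integrable \<mu> (\<lambda>s. L * real CARD('k) * \<eta> * norm (v s))"
      using int by simp
    fix s assume "s \<in> space \<mu>"
    then have s: "s \<in> {0..1}" by simp
    have "norm (indicat_real {0..t} s *\<^sub>R ?f s) \<le> norm (?f s)"
      by (simp add: indicator_def)
    also have "\<dots> \<le> L * (real CARD('k) * norm (v s)) * (norm (y' s - y s) + norm (\<theta>' - \<theta>))"
      by (rule F_mult_lipschitz[OF \<theta>(2,1)])
    also have "\<dots> \<le> L * (real CARD('k) * norm (v s)) * \<eta>"
      using L_pos by (intro mult_left_mono \<eta> s) auto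
    finally show "norm (indicat_real {0..t} s *\<^sub>R ?f s) \<le> L * real CARD('k) * \<eta> * norm (v s)"
      by (simp add: mult_ac)
  qed
  also have "\<dots> = L * real CARD('k) * \<eta> * (LINT s|\<mu>. norm (v s))"
    by simp
  also have "\<dots> \<le> L * real CARD('k) * \<eta> * B"
    using LINT_norm_le_L2_norm[OF v(1)] v(2) L_pos \<open>\<eta> \<ge> 0\<close> by (intro mult_left_mono) auto
  finally show ?thesis by (simp add: mult_ac)
qed

text \<open>A bound in L1 would not prevent controls from concentrating in time; the L2 bound does,
  by Cauchy-Schwarz against the difference of the cut-offs.\<close>

lemma response_time_diff:
  assumes y: "continuous_on {0..1} y" and \<theta>: "\<theta> \<in> \<Theta>"
    and C: "\<And>s w. s \<in> {0..1} \<Longrightarrow> norm (F (y s) \<theta> *v w) \<le> C * norm w" "C > 0"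
    and v: "square_integrable \<mu> v" "L2_norm \<mu> v \<le> B"
    and t: "t \<in> {0..1}" "t' \<in> {0..1}"
  shows "norm (response v y \<theta> t' - response v y \<theta> t) \<le> C * B * sqrt \<bar>t' - t\<bar>"
proof -
  let ?i = "\<lambda>s. indicat_real {0..t'} s - indicator {0..t} s"
  note i = L2_norm_indicator_diff[OF t(2,1)]
  have int: "integrable \<mu> (\<lambda>s. indicator {0..r} s *\<^sub>R (F (y s) \<theta> *v v s))" if "r \<in> {0..1}" for r
    by (intro integrable_mult_indicator sets_lebesgue_on_Icc that
        square_integrable_imp_integrable_interval F_mult_square_integrable y \<theta> v)
  have "response v y \<theta> t' - response v y \<theta> t = (LINT s|\<mu>. ?i s *\<^sub>R (F (y s) \<theta> *v v s))"
    unfolding response_def scaleR_diff_left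
    by (intro Bochner_Integration.integral_diff[symmetric] int t)
  also have "norm \<dots> \<le> (LINT s|\<mu>. C * (norm (?i s) * norm (v s)))"
  proof (rule norm_LINT_le)
    show "(\<lambda>s. ?i s *\<^sub>R (F (y s) \<theta> *v v s)) \<in> borel_measurable \<mu>"
      unfolding scaleR_diff_left by (intro borel_measurable_diff borel_measurable_integrable int t)
    show "integrable \<mu> (\<lambda>s. C * (norm (?i s) * norm (v s)))"
      by (intro integrable_mult_right L2_Cauchy_Schwarz(1)[OF i(1) v(1)])
    fix s assume "s \<in> space \<mu>"
    then show "norm (?i s *\<^sub>R (F (y s) \<theta> *v v s)) \<le> C * (norm (?i s) * norm (v s))"
      unfolding norm_scaleR using mult_left_mono[OF C(1)[of s "v s"], of "\<bar>?i s\<bar>"] by (simp add: mult_ac)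
  qed
  also have "\<dots> = C * (LINT s|\<mu>. norm (?i s) * norm (v s))"
    by simp
  also have "\<dots> \<le> C * (sqrt \<bar>t' - t\<bar> * B)"
  proof (rule mult_left_mono)
    have "(LINT s|\<mu>. norm (?i s) * norm (v s)) \<le> L2_norm \<mu> ?i * L2_norm \<mu> v"
      by (rule L2_Cauchy_Schwarz(2)[OF i(1) v(1)])
    also have "\<dots> \<le> sqrt \<bar>t' - t\<bar> * B"
      unfolding i(2) by (intro mult_left_mono v) simp
    finally show "(LINT s|\<mu>. norm (?i s) * norm (v s)) \<le> sqrt \<bar>t' - t\<bar> * B" .
  qed (use C in simp)
  finally show ?thesis by (simp add: mult_ac)
qed

lemma trajectory_continuous_in_parameter:
  assumes Y: "\<And>\<theta>. \<theta> \<in> \<Theta> \<Longrightarrow> is_trajectory F0 F x0 u \<theta> (Y \<theta>)" and u: "square_integrable \<mu> u"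
    and x0: "continuous_on \<Theta> x0" and \<theta>: "\<theta> \<in> \<Theta>" and "e > 0"
  shows "\<exists>d>0. \<forall>\<theta>'\<in>\<Theta>. dist \<theta>' \<theta> < d \<longrightarrow> (\<forall>s\<in>{0..1}. norm (Y \<theta>' s - Y \<theta> s) + norm (\<theta>' - \<theta>) < e)"
proof -
  define \<beta> where "\<beta> = L * (1 + real CARD('k) * L2_norm \<mu> u)"
  \<comment> \<open>The stability bound for \<open>\<rho> = 0\<close>, hence the \<open>+ 0\<close>,
    plus the parameter distance. It vanishes at \<open>\<theta>\<close> and does not involve
    \<open>s\<close>, so its continuity gives a radius uniform in time.\<close>
  define g where "g \<theta>' = 2 * (norm (x0 \<theta>' - x0 \<theta>) + \<beta> * norm (\<theta>' - \<theta>) + 0) * exp (2 * \<beta>\<^sup>2) + norm (\<theta>' - \<theta>)"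
    for \<theta>'
  have "continuous_on \<Theta> g"
    unfolding g_def by (intro continuous_intros x0)
  then obtain d where d: "d > 0" "\<And>\<theta>'. \<theta>' \<in> \<Theta> \<Longrightarrow> dist \<theta>' \<theta> < d \<Longrightarrow> dist (g \<theta>') (g \<theta>) < e"
    using \<theta> \<open>e > 0\<close> unfolding continuous_on_iff by metis
  have "norm (Y \<theta>' s - Y \<theta> s) + norm (\<theta>' - \<theta>) < e" if "\<theta>' \<in> \<Theta>" "dist \<theta>' \<theta> < d" "s \<in> {0..1}" for \<theta>' s
  proof -
    have "norm (Y \<theta>' s - Y \<theta> s)
        \<le> 2 * (norm (x0 \<theta>' - x0 \<theta>) + \<beta> * norm (\<theta>' - \<theta>) + 0) * exp (2 * \<beta>\<^sup>2)"
      unfolding \<beta>_def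
      by (rule trajectory_stability[OF Y[OF that(1)] Y[OF \<theta>] that(1) \<theta> u u order_refl _ that(3)])
         (simp add: response_def)
    then have "norm (Y \<theta>' s - Y \<theta> s) + norm (\<theta>' - \<theta>) \<le> g \<theta>'"
      by (simp add: g_def)
    also have "g \<theta>' < e"
      using d(2)[OF that(1,2)] by (simp add: dist_real_def g_def)
    finally show ?thesis .
  qed
  with d(1) show ?thesis by blast
qed

lemma response_uniformly_tendsto_zero:
  fixes v :: "nat \<Rightarrow> real \<Rightarrow> real ^ 'k"
  assumes "compact \<Theta>" and x0: "continuous_on \<Theta> x0" and u: "square_integrable \<mu> u"
    and Y: "\<And>\<theta>. \<theta> \<in> \<Theta> \<Longrightarrow> is_trajectory F0 F x0 u \<theta> (Y \<theta>)"
    and v: "\<And>m. square_integrable \<mu> (v m)" and B: "\<And>m. L2_norm \<mu> (v m) \<le> B" "B > 0"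
    and weak: "\<And>w. square_integrable \<mu> w \<Longrightarrow> (\<lambda>m. LINT s|\<mu>. v m s \<bullet> w s) \<longlonglongrightarrow> 0"
    and "e > 0"
  shows "\<forall>\<^sub>F m in sequentially. \<forall>t\<in>{0..1}. \<forall>\<theta>\<in>\<Theta>. norm (response (v m) (Y \<theta>) \<theta> t) < e"
proof -
  note cont = trajectory_continuous[OF Y]
  have "\<forall>\<^sub>F m in sequentially. \<forall>p\<in>{0..1} \<times> \<Theta>. norm (response (v m) (Y (snd p)) (snd p) (fst p)) < e"
  proof (rule equicontinuous_tendsto_zero_imp_uniform)
    show "compact ({0..1::real} \<times> \<Theta>)"
      by (intro compact_Times compact_Icc \<open>compact \<Theta>\<close>)
    show "(\<lambda>m. response (v m) (Y (snd p)) (snd p) (fst p)) \<longlonglongrightarrow> 0" if "p \<in> {0..1} \<times> \<Theta>" for p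
      using that by (intro response_tendsto_zero cont v weak) auto
  next
    fix p :: "real \<times> 'p" and \<epsilon> :: real
    assume "p \<in> {0..1} \<times> \<Theta>" "\<epsilon> > 0"
    then obtain t \<theta> where p: "p = (t, \<theta>)" and t: "t \<in> {0..1}" and \<theta>: "\<theta> \<in> \<Theta>"
      by auto
    obtain C where C: "C > 0" "\<And>s w. s \<in> {0..1} \<Longrightarrow> norm (F (Y \<theta> s) \<theta> *v w) \<le> C * norm w"
      using F_mult_bounded[OF cont[OF \<theta>] \<theta>] by metis
    \<comment> \<open>The factor in \<open>response_parameter_diff\<close>: a variation below
      \<open>\<epsilon> / (2 * K)\<close> costs at most \<open>\<epsilon> / 2\<close>.\<close>
    define K where "K = L * real CARD('k) * B"
    have "K > 0" using L_pos B by (simp add: K_def)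
    then have "\<epsilon> / (2 * K) > 0" using \<open>\<epsilon> > 0\<close> by simp
    from trajectory_continuous_in_parameter[OF Y u x0 \<theta> this] obtain d1 where d1: "d1 > 0"
      "\<And>\<theta>' s. \<theta>' \<in> \<Theta> \<Longrightarrow> dist \<theta>' \<theta> < d1 \<Longrightarrow> s \<in> {0..1} \<Longrightarrow>
         norm (Y \<theta>' s - Y \<theta> s) + norm (\<theta>' - \<theta>) < \<epsilon> / (2 * K)"
      by blast
    \<comment> \<open>Solves \<open>C * B * sqrt d2 = \<epsilon> / 2\<close>.\<close>
    define d2 where "d2 = (\<epsilon> / (2 * (C * B)))\<^sup>2"
    have "C * B > 0" using C(1) B(2) by simp
    have "d2 > 0" using C(1) B(2) \<open>\<epsilon> > 0\<close> by (simp add: d2_def)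
    \<comment> \<open>The parameter is moved first, at time \<open>t'\<close>, and the time
      afterwards along \<open>Y \<theta>\<close>; thus \<open>C\<close> is a bound for the central
      trajectory only, fixed before the radius.\<close>
    have "norm (response (v m) (Y \<theta>') \<theta>' t' - response (v m) (Y \<theta>) \<theta> t) < \<epsilon>"
      if t': "t' \<in> {0..1}" "\<theta>' \<in> \<Theta>" and d: "dist (t', \<theta>') (t, \<theta>) < min d1 d2" for m t' \<theta>'
    proof -
      have dd: "dist \<theta>' \<theta> < d1" "dist t' t < d2"
        using d dist_fst_le[of "(t', \<theta>')" "(t, \<theta>)"] dist_snd_le[of "(t', \<theta>')" "(t, \<theta>)"] by auto
      have "norm (response (v m) (Y \<theta>') \<theta>' t' - response (v m) (Y \<theta>) \<theta> t')
          \<le> L * real CARD('k) * B * (\<epsilon> / (2 * K))"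
        using d1(2)[OF t'(2) dd(1)]
        by (intro response_parameter_diff cont \<theta> t' v B) (simp add: less_imp_le)
      also have "\<dots> = \<epsilon> / 2"
        unfolding K_def[symmetric] using \<open>K > 0\<close> by simp
      finally have 1: "norm (response (v m) (Y \<theta>') \<theta>' t' - response (v m) (Y \<theta>) \<theta> t') \<le> \<epsilon> / 2" .
      have "norm (response (v m) (Y \<theta>) \<theta> t' - response (v m) (Y \<theta>) \<theta> t) \<le> C * B * sqrt \<bar>t' - t\<bar>"
        by (rule response_time_diff[OF cont[OF \<theta>] \<theta> C(2,1) v B(1) t t'(1)])
      also have "\<dots> < C * B * (\<epsilon> / (2 * (C * B)))"
      proof (rule mult_strict_left_mono)
        have "sqrt \<bar>t' - t\<bar> < sqrt d2"
          using dd(2) by (simp add: dist_real_def)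
        also have "sqrt d2 = \<epsilon> / (2 * (C * B))"
          unfolding d2_def using \<open>C * B > 0\<close> \<open>\<epsilon> > 0\<close> by (intro real_sqrt_unique) auto
        finally show "sqrt \<bar>t' - t\<bar> < \<epsilon> / (2 * (C * B))" .
      qed (rule \<open>C * B > 0\<close>)
      also have "\<dots> = \<epsilon> / 2"
        using C(1) B(2) by simp
      finally have 2: "norm (response (v m) (Y \<theta>) \<theta> t' - response (v m) (Y \<theta>) \<theta> t) < \<epsilon> / 2" .
      have "response (v m) (Y \<theta>') \<theta>' t' - response (v m) (Y \<theta>) \<theta> t
        = (response (v m) (Y \<theta>') \<theta>' t' - response (v m) (Y \<theta>) \<theta> t')
          + (response (v m) (Y \<theta>) \<theta> t' - response (v m) (Y \<theta>) \<theta> t)"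
        by simp
      also have "norm \<dots> < \<epsilon>"
        using 1 2 by (intro le_less_trans[OF norm_triangle_ineq]) simp
      finally show ?thesis .
    qed
    then show "\<exists>d>0. \<forall>m. \<forall>q\<in>{0..1} \<times> \<Theta>. dist q p < d \<longrightarrow>
        norm (response (v m) (Y (snd q)) (snd q) (fst q) - response (v m) (Y (snd p)) (snd p) (fst p)) < \<epsilon>"
      using d1(1) \<open>d2 > 0\<close> by (intro exI[of _ "min d1 d2"]) (auto simp: p)
  qed (rule \<open>e > 0\<close>)
  then show ?thesis
    by eventually_elim auto
qed

end

section \<open>Return to the definitions of the statement, and conclusion\<close>

lemma L2_controls_iff: "u \<in> L2_controls \<longleftrightarrow> square_integrable (lebesgue_on {0..1}) u"
  by (simp add: L2_controls_def square_integrable_def)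

lemma weakly_converges_L2_bounded:
  assumes "weakly_converges_L2 u v"
  obtains B where "B > 0" "\<And>m. L2_norm (lebesgue_on {0..1}) (u m) \<le> B"
proof (rule L2_uniform_boundedness)
  show "square_integrable (lebesgue_on {0..1}) (u m)" for m
    using assms by (simp add: weakly_converges_L2_def L2_controls_iff)
  show "Bseq (\<lambda>m. LINT x|lebesgue_on {0..1}. u m x \<bullet> w x)"
    if "square_integrable (lebesgue_on {0..1}) w" for w
  proof -
    have "(\<lambda>m. LINT x|lebesgue_on {0..1}. u m x \<bullet> w x) \<longlonglongrightarrow> (LINT x|lebesgue_on {0..1}. v x \<bullet> w x)"
      using assms that by (simp add: weakly_converges_L2_def L2_controls_iff)
    then show ?thesis
      by (rule convergent_imp_Bseq[OF convergentI])
  qed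
qed (rule that)

text \<open>In \<open>ennreal\<close> every supremum exists, and it is \<open>0\<close> over the
  empty set, so the limit is meaningful for any family. The index \<open>\<infinity>\<close> of
  \<open>enat\<close> carries the limit control and its trajectories.\<close>

theorem proposition1p2:
  fixes \<Theta> :: "('p::euclidean_space) set"
    and F0 :: "real ^ 'n \<Rightarrow> 'p \<Rightarrow> real ^ 'n"
    and F :: "real ^ 'n \<Rightarrow> 'p \<Rightarrow> real ^ 'k ^ 'n"
    and x0 :: "'p \<Rightarrow> real ^ 'n"
    and L :: real
    and u :: "enat \<Rightarrow> real \<Rightarrow> real ^ 'k"
    and X :: "enat \<Rightarrow> real \<Rightarrow> 'p \<Rightarrow> real ^ 'n"
  assumes "compact \<Theta>"
    and "L > 0"
    and "\<And>x1 x2 \<theta>1 \<theta>2. \<theta>1 \<in> \<Theta> \<Longrightarrow> \<theta>2 \<in> \<Theta> \<Longrightarrow>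
           norm (F0 x1 \<theta>1 - F0 x2 \<theta>2) \<le> L * (norm (x1 - x2) + norm (\<theta>1 - \<theta>2))"
    and "\<And>i x1 x2 \<theta>1 \<theta>2. \<theta>1 \<in> \<Theta> \<Longrightarrow> \<theta>2 \<in> \<Theta> \<Longrightarrow>
           norm (column i (F x1 \<theta>1) - column i (F x2 \<theta>2)) \<le> L * (norm (x1 - x2) + norm (\<theta>1 - \<theta>2))"
    and "continuous_on \<Theta> x0"
    and "weakly_converges_L2 (\<lambda>m. u (enat m)) (u \<infinity>)"
    and "\<And>m \<theta>. \<theta> \<in> \<Theta> \<Longrightarrow> is_trajectory F0 F x0 (u m) \<theta> (\<lambda>t. X m t \<theta>)"
  shows "(\<lambda>m. SUP (t, \<theta>)\<in>{0..1} \<times> \<Theta>. ennreal (norm (X (enat m) t \<theta> - X \<infinity> t \<theta>)))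
           \<longlonglongrightarrow> 0"
proof -
  interpret lipschitz_control_system \<Theta> F0 F L
    by standard (fact assms)+
  have sq: "square_integrable \<mu> (u (enat m))" "square_integrable \<mu> (u \<infinity>)" for m
    using assms(6) by (simp_all add: weakly_converges_L2_def L2_controls_iff)
  obtain B where B: "B > 0" "\<And>m. L2_norm \<mu> (u (enat m)) \<le> B"
    using weakly_converges_L2_bounded[OF assms(6)] by blast
  define v where "v m s = u (enat m) s - u \<infinity> s" for m s
  have v: "square_integrable \<mu> (v m)" for m
    unfolding v_def by (intro square_integrable_diff sq)
  have weak: "(\<lambda>m. LINT s|\<mu>. v m s \<bullet> w s) \<longlonglongrightarrow> 0" if w: "square_integrable \<mu> w" for w
  proof -
    have "(\<lambda>m. (LINT s|\<mu>. u (enat m) s \<bullet> w s) - (LINT s|\<mu>. u \<infinity> s \<bullet> w s))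
        \<longlonglongrightarrow> (LINT s|\<mu>. u \<infinity> s \<bullet> w s) - (LINT s|\<mu>. u \<infinity> s \<bullet> w s)"
      using assms(6) w by (intro tendsto_diff) (auto simp: weakly_converges_L2_def L2_controls_iff)
    moreover have "(LINT s|\<mu>. v m s \<bullet> w s) = (LINT s|\<mu>. u (enat m) s \<bullet> w s) - (LINT s|\<mu>. u \<infinity> s \<bullet> w s)" for m
      unfolding v_def inner_diff_left
      by (intro Bochner_Integration.integral_diff L2_inner_integrable sq w)
    ultimately show ?thesis by simp
  qed
  \<comment> \<open>\<open>B\<close> bounds the controls and enters \<open>\<beta>\<close>;
    \<open>B'\<close> bounds the differences and enters the equicontinuity. Applying uniform
    boundedness to \<open>v\<close>, which tends weakly to zero, replaces a triangle inequality for
    \<open>L2_norm\<close>.\<close>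
  obtain B' where B': "B' > 0" "\<And>m. L2_norm \<mu> (v m) \<le> B'"
  proof (rule L2_uniform_boundedness[OF v])
    show "Bseq (\<lambda>m. LINT s|\<mu>. v m s \<bullet> w s)" if "square_integrable \<mu> w" for w
      by (rule convergent_imp_Bseq[OF convergentI[OF weak[OF that]]])
  qed (rule that)
  define \<beta> where "\<beta> = L * (1 + real CARD('k) * B)"
  show ?thesis
  proof (rule tendsto_zero_ennreal)
    fix r :: real
    assume "r > 0"
    \<comment> \<open>Stability turns a response below \<open>e\<close> into a distance of at most
      \<open>2 * e * exp (2 * \<beta>\<^sup>2) = r / 2\<close>. The supremum preserves only weak
      bounds, and the spare factor 2 keeps it strictly below \<open>r\<close>.\<close>
    define e where "e = r / (4 * exp (2 * \<beta>\<^sup>2))"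
    have "e > 0" using \<open>r > 0\<close> by (simp add: e_def)
    have "\<forall>\<^sub>F m in sequentially. \<forall>t\<in>{0..1}. \<forall>\<theta>\<in>\<Theta>. norm (response (v m) (\<lambda>s. X \<infinity> s \<theta>) \<theta> t) < e"
      by (rule response_uniformly_tendsto_zero[OF assms(1,5) sq(2) assms(7) v B'(2,1) weak \<open>e > 0\<close>])
    then show "\<forall>\<^sub>F m in sequentially.
        (SUP (t, \<theta>)\<in>{0..1} \<times> \<Theta>. ennreal (norm (X (enat m) t \<theta> - X \<infinity> t \<theta>))) < ennreal r"
    proof eventually_elim
      case (elim m)
      have "norm (X (enat m) t \<theta> - X \<infinity> t \<theta>) \<le> r / 2" if "t \<in> {0..1}" "\<theta> \<in> \<Theta>" for t \<theta>
      proof -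
        have "norm (X (enat m) t \<theta> - X \<infinity> t \<theta>)
            \<le> 2 * (norm (x0 \<theta> - x0 \<theta>) + \<beta> * norm (\<theta> - \<theta>) + e) * exp (2 * \<beta>\<^sup>2)"
          unfolding \<beta>_def
          by (rule trajectory_stability[OF assms(7)[OF that(2)] assms(7)[OF that(2)] that(2) that(2) sq B(2) _ that(1)])
             (use elim that in \<open>auto simp: v_def[abs_def] less_imp_le\<close>)
        also have "\<dots> = r / 2" by (simp add: e_def)
        finally show ?thesis .
      qed
      then have "(SUP (t, \<theta>)\<in>{0..1} \<times> \<Theta>. ennreal (norm (X (enat m) t \<theta> - X \<infinity> t \<theta>))) \<le> ennreal (r / 2)"
        by (intro SUP_least) (auto intro: ennreal_leI)
      also have "\<dots> < ennreal r"
        using \<open>r > 0\<close> by (simp add: ennreal_less_iff)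
      finally show ?case .
    qed
  qed
qed

end
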